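(* Let $M$ be a compact manifold with a volume form $\omega$, let $f:M\to M$ be a $\mathcal{C}^1$-diffeomorphism preserving $\omega$, and let $p\in M$ be a hyperbolic periodic point of $f$. Assume that $f$ has the shadowing property. If $q\in W^u(p,f)$ is a recurrent point of $f$, then $q$ lies in the limit set of the homoclinic points of $p$, i.e., there is a sequence of homoclinic points of $p$ converging to $q$.
   Context: $M$ is an $n$-dimensional differentiable manifold with a metric $d$ inducing its topology. A volume form is a nowhere vanishing $n$-form; $f$ preserves $\omega$ if $f^*\omega=\omega$. A periodic point $p$ of period $k$ is hyperbolic if all ($n$, counted with multiplicity) eigenvalues of $D(f^k)_p:T_pM\to T_pM$ have absolute value different from $1$. Stable and unstable manifolds: $W^s(p,f)=\{u\in M: d(f^n(u),f^n(p))\to 0 \text{ as } n\to\infty\}$ and $W^u(p,f)=\{u\in M: d(f^{-n}(u),f^{-n}(p))\to 0\text{ as } n\to\infty\}$. A homoclinic point of $p$ is a point $q\in W^s(p,f)\cap W^u(p,f)$ with $q\ne p$. A point $q$ is (positively) recurrent if $q\in\omega(q,f)$, where $\omega(q,f)$ is the set of limits $\lim_{j\to\infty} f^{n_j}(q)$ over integer sequences $n_j\to\infty$. A $\delta$-pseudo-orbit of $f$ is a sequence $(x_i)_{i\in\mathbb{Z}}$ in $M$ with $d(x_{i+1},f(x_i))<\delta$ for all $i\in\mathbb{Z}$; it is $\epsilon$-shadowed by the orbit of $x\in M$ if $d(x_i,f^i(x))<\epsilon$ for all $i\in\mathbb{Z}$. The map $f$ has the shadowing property if for every $\epsilon>0$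 there is $\delta>0$ such that every $\delta$-pseudo-orbit is $\epsilon$-shadowed by some orbit of $f$. *)

theory Defs
  imports "HOL-Analysis.Analysis" "HOL-Library.Extended_Nat"
begin

section \<open>Differentiable manifolds\<close>

text \<open>
  A manifold is given by an atlas on a whole type of class \<open>metric_space\<close>, so the metric is the
  one of the type class and it induces the manifold topology.  The model space is \<open>real ^ 'n\<close>;
  the dimension is \<open>CARD('n)\<close>, in particular at least 1, and there is no boundary.
\<close>

text \<open>\<open>k\<close> times continuously differentiable; meant for open \<open>S\<close>.\<close>

primrec Ck_on ::
  "nat \<Rightarrow> ('e::real_normed_vector \<Rightarrow> 'f::real_normed_vector) \<Rightarrow> 'e set \<Rightarrow> bool" where
  "Ck_on 0 g S \<longleftrightarrow> continuous_on S g"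
| "Ck_on (Suc k) g S \<longleftrightarrow>
     (\<forall>x\<in>S. g differentiable (at x)) \<and> (\<forall>v. Ck_on k (\<lambda>x. frechet_derivative g (at x) v) S)"

type_synonym ('a, 'n) chart = "'a set \<times> ('a \<Rightarrow> real ^ 'n)"

definition chart_inv :: "('a, 'n) chart \<Rightarrow> real ^ 'n \<Rightarrow> 'a" where
  "chart_inv c = inv_into (fst c) (snd c)"

definition is_chart :: "('a::metric_space, 'n::finite) chart \<Rightarrow> bool" where
  "is_chart c \<longleftrightarrow> open (fst c) \<and> open (snd c ` fst c) \<and>
     homeomorphism (fst c) (snd c ` fst c) (snd c) (chart_inv c)"

definition local_rep ::
  "('a, 'n) chart \<Rightarrow> ('a, 'n) chart \<Rightarrow> ('a \<Rightarrow> 'a) \<Rightarrow> real ^ 'n \<Rightarrow> real ^ 'n" where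
  "local_rep c d f = snd d \<circ> f \<circ> chart_inv c"

text \<open>
  The atlas of a manifold of class \<open>C\<^sup>r\<close> with \<open>1 \<le> r \<le> \<infinity>\<close>.
  It is not required to be maximal.
\<close>

definition manifold_atlas :: "enat \<Rightarrow> ('a::metric_space, 'n::finite) chart set \<Rightarrow> bool" where
  "manifold_atlas r A \<longleftrightarrow> 1 \<le> r \<and> (\<forall>c\<in>A. is_chart c) \<and> (\<Union>c\<in>A. fst c) = UNIV \<and>
     (\<forall>c\<in>A. \<forall>d\<in>A. \<forall>k. enat k \<le> r \<longrightarrow>
        Ck_on k (local_rep c d id) (snd c ` (fst c \<inter> fst d)))"

definition C1_map :: "('a::metric_space, 'n::finite) chart set \<Rightarrow> ('a \<Rightarrow> 'a) \<Rightarrow> bool" where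
  "C1_map A f \<longleftrightarrow> continuous_on UNIV f \<and>
     (\<forall>c\<in>A. \<forall>d\<in>A. Ck_on 1 (local_rep c d f) (snd c ` (fst c \<inter> f -` fst d)))"

definition C1_diffeo :: "('a::metric_space, 'n::finite) chart set \<Rightarrow> ('a \<Rightarrow> 'a) \<Rightarrow> bool" where
  "C1_diffeo A f \<longleftrightarrow> bij f \<and> C1_map A f \<and> C1_map A (inv f)"

subsection \<open>Tangent spaces and tangent maps\<close>

text \<open>
  A tangent vector at \<open>p\<close> is the family of its coordinate vectors in all charts around \<open>p\<close>, related
  by the derivatives of the chart changes.  The value at anything that is not a chart around \<open>p\<close>
  is fixed to 0.
\<close>

type_synonym ('a, 'n) tvec = "('a, 'n) chart \<Rightarrow> real ^ 'n"

definition charts_at :: "('a, 'n) chart set \<Rightarrow> 'a \<Rightarrow> ('a, 'n) chart set" where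
  "charts_at A p = {c \<in> A. p \<in> fst c}"

definition tangent_space ::
  "('a, 'n::finite) chart set \<Rightarrow> 'a \<Rightarrow> ('a, 'n) tvec set" where
  "tangent_space A p = {v.
     (\<forall>c\<in>charts_at A p. \<forall>d\<in>charts_at A p.
        v d = frechet_derivative (local_rep c d id) (at (snd c p)) (v c)) \<and>
     (\<forall>c. c \<notin> charts_at A p \<longrightarrow> v c = 0)}"

definition tlin ::
  "real \<Rightarrow> ('a, 'n::finite) tvec \<Rightarrow> real \<Rightarrow> ('a, 'n) tvec \<Rightarrow> ('a, 'n) tvec" where
  "tlin a u b v = (\<lambda>c. a *\<^sub>R u c + b *\<^sub>R v c)"

text \<open>The tangent vector at \<open>p\<close> with coordinate vector \<open>w\<close> in the chart \<open>c\<close>.\<close>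

definition tvec_of ::
  "('a, 'n::finite) chart set \<Rightarrow> ('a, 'n) chart \<Rightarrow> 'a \<Rightarrow> real ^ 'n \<Rightarrow> ('a, 'n) tvec" where
  "tvec_of A c p w = (\<lambda>d. if d \<in> charts_at A p
     then frechet_derivative (local_rep c d id) (at (snd c p)) w else 0)"

text \<open>
  The tangent map \<open>Df\<^sub>p\<close> from the tangent space at \<open>p\<close> to the one at \<open>f p\<close>, computed in
  some pair of charts; by the chain rule the result does not depend on the choice.
\<close>

definition tangent_map ::
  "('a, 'n::finite) chart set \<Rightarrow> ('a \<Rightarrow> 'a) \<Rightarrow> 'a \<Rightarrow> ('a, 'n) tvec \<Rightarrow> ('a, 'n) tvec" where
  "tangent_map A f p v =
     (let c = (SOME c. c \<in> charts_at A p); d = (SOME d. d \<in> charts_at A (f p))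
      in tvec_of A d (f p) (frechet_derivative (local_rep c d f) (at (snd c p)) (v c)))"

subsection \<open>Volume forms\<close>

text \<open>
  Forms of top degree: the arguments are indexed by \<open>'n\<close>, so their number is the dimension.
\<close>

type_synonym ('a, 'n) top_form = "'a \<Rightarrow> ('n \<Rightarrow> ('a, 'n) tvec) \<Rightarrow> real"

definition alternating_multilinear ::
  "('a, 'n::finite) tvec set \<Rightarrow> (('n \<Rightarrow> ('a, 'n) tvec) \<Rightarrow> real) \<Rightarrow> bool" where
  "alternating_multilinear T \<alpha> \<longleftrightarrow>
     (\<forall>v i x y a b. (\<forall>j. v j \<in> T) \<and> x \<in> T \<and> y \<in> T \<longrightarrow>
        \<alpha> (v(i := tlin a x b y)) = a * \<alpha> (v(i := x)) + b * \<alpha> (v(i := y))) \<and>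
     (\<forall>v i j. (\<forall>l. v l \<in> T) \<and> i \<noteq> j \<and> v i = v j \<longrightarrow> \<alpha> v = 0)"

text \<open>
  On a manifold of class \<open>C\<^sup>r\<close> the highest regularity that makes sense for a form is
  \<open>C\<^sup>r\<^sup>-\<^sup>1\<close> (smooth if \<open>r = \<infinity>\<close>).  It is imposed on the values of the form on all coordinate
  vector fields with constant coefficients.
\<close>

definition volume_form ::
  "enat \<Rightarrow> ('a::metric_space, 'n::finite) chart set \<Rightarrow> ('a, 'n) top_form \<Rightarrow> bool" where
  "volume_form r A \<omega> \<longleftrightarrow>
     (\<forall>p. alternating_multilinear (tangent_space A p) (\<omega> p)) \<and>
     (\<forall>c\<in>A. \<forall>e. \<forall>k. enat (Suc k) \<le> r \<longrightarrow>
        Ck_on k (\<lambda>y. \<omega> (chart_inv c y) (\<lambda>i. tvec_of A c (chart_inv c y) (e i)))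
          (snd c ` fst c)) \<and>
     (\<forall>p. \<exists>v. (\<forall>i. v i \<in> tangent_space A p) \<and> \<omega> p v \<noteq> 0)"

definition pullback ::
  "('a, 'n::finite) chart set \<Rightarrow> ('a \<Rightarrow> 'a) \<Rightarrow> ('a, 'n) top_form \<Rightarrow> ('a, 'n) top_form" where
  "pullback A f \<omega> p v = \<omega> (f p) (\<lambda>i. tangent_map A f p (v i))"

text \<open>Only the values of a form on tangent vectors are meaningful.\<close>

definition preserves_form ::
  "('a, 'n::finite) chart set \<Rightarrow> ('a \<Rightarrow> 'a) \<Rightarrow> ('a, 'n) top_form \<Rightarrow> bool" where
  "preserves_form A f \<omega> \<longleftrightarrow>
     (\<forall>p v. (\<forall>i. v i \<in> tangent_space A p) \<longrightarrow> pullback A f \<omega> p v = \<omega> p v)"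

subsection \<open>Hyperbolic periodic points\<close>

text \<open>
  \<open>\<mu>\<close> is an eigenvalue of the complexification of \<open>L\<close>; the pair \<open>(u, w)\<close> stands for the
  complex eigenvector \<open>u + \<i> w\<close>.
\<close>

definition complex_eigenvalue ::
  "('a, 'n::finite) tvec set \<Rightarrow> (('a, 'n) tvec \<Rightarrow> ('a, 'n) tvec) \<Rightarrow> complex \<Rightarrow> bool" where
  "complex_eigenvalue T L \<mu> \<longleftrightarrow>
     (\<exists>u\<in>T. \<exists>w\<in>T. (u \<noteq> (\<lambda>_. 0) \<or> w \<noteq> (\<lambda>_. 0)) \<and>
        L u = tlin (Re \<mu>) u (- Im \<mu>) w \<and> L w = tlin (Im \<mu>) u (Re \<mu>) w)"

definition hyperbolic_periodic_point ::
  "('a, 'n::finite) chart set \<Rightarrow> ('a \<Rightarrow> 'a) \<Rightarrow> nat \<Rightarrow> 'a \<Rightarrow> bool" where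
  "hyperbolic_periodic_point A f k p \<longleftrightarrow> 0 < k \<and> (f ^^ k) p = p \<and>
     (\<forall>\<mu>. complex_eigenvalue (tangent_space A p) (tangent_map A (f ^^ k) p) \<mu> \<longrightarrow> cmod \<mu> \<noteq> 1)"

section \<open>Dynamics of invertible maps\<close>

definition iter :: "('a \<Rightarrow> 'a) \<Rightarrow> int \<Rightarrow> 'a \<Rightarrow> 'a" where
  "iter f i = (if 0 \<le> i then f ^^ nat i else inv f ^^ nat (- i))"

definition stable_manifold :: "('a::metric_space \<Rightarrow> 'a) \<Rightarrow> 'a \<Rightarrow> 'a set" where
  "stable_manifold f p = {u. (\<lambda>n. dist ((f ^^ n) u) ((f ^^ n) p)) \<longlonglongrightarrow> 0}"

definition unstable_manifold :: "('a::metric_space \<Rightarrow> 'a) \<Rightarrow> 'a \<Rightarrow> 'a set" where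
  "unstable_manifold f p = {u. (\<lambda>n. dist ((inv f ^^ n) u) ((inv f ^^ n) p)) \<longlonglongrightarrow> 0}"

definition homoclinic_points :: "('a::metric_space \<Rightarrow> 'a) \<Rightarrow> 'a \<Rightarrow> 'a set" where
  "homoclinic_points f p = (stable_manifold f p \<inter> unstable_manifold f p) - {p}"

definition omega_limit :: "('a::metric_space \<Rightarrow> 'a) \<Rightarrow> 'a \<Rightarrow> 'a set" where
  "omega_limit f q =
     {y. \<exists>s :: nat \<Rightarrow> int. filterlim s at_top sequentially \<and> (\<lambda>j. iter f (s j) q) \<longlonglongrightarrow> y}"

definition recurrent_point :: "('a::metric_space \<Rightarrow> 'a) \<Rightarrow> 'a \<Rightarrow> bool" where
  "recurrent_point f q \<longleftrightarrow> q \<in> omega_limit f q"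

definition pseudo_orbit ::
  "('a::metric_space \<Rightarrow> 'a) \<Rightarrow> real \<Rightarrow> (int \<Rightarrow> 'a) \<Rightarrow> bool" where
  "pseudo_orbit f \<delta> x \<longleftrightarrow> (\<forall>i. dist (x (i + 1)) (f (x i)) < \<delta>)"

definition shadowed_by ::
  "('a::metric_space \<Rightarrow> 'a) \<Rightarrow> real \<Rightarrow> (int \<Rightarrow> 'a) \<Rightarrow> 'a \<Rightarrow> bool" where
  "shadowed_by f \<epsilon> x y \<longleftrightarrow> (\<forall>i. dist (x i) (iter f i y) < \<epsilon>)"

definition shadowing_property :: "('a::metric_space \<Rightarrow> 'a) \<Rightarrow> bool" where
  "shadowing_property f \<longleftrightarrow>
     (\<forall>\<epsilon>>0. \<exists>\<delta>>0. \<forall>x. pseudo_orbit f \<delta> x \<longrightarrow> (\<exists>y. shadowed_by f \<epsilon> x y))"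

end

theory Submission
  imports Defs "HOL-Computational_Algebra.Fundamental_Theorem_Algebra"
begin

text \<open>
  The idea is to shadow a pseudo-orbit that comes out of the orbit of \<open>p\<close>, passes through the
  point of interest, and ends on the orbit of \<open>p\<close> again.  A shadowing orbit stays within a small
  \<open>\<epsilon>\<close> of the orbit of \<open>p\<close> at all sufficiently negative and all sufficiently positive times.
  A hyperbolic periodic point is isolated: near \<open>p\<close>, the only complete orbit of \<open>f ^^ k\<close> is the
  constant one (\<open>hyperbolic_isolated\<close>).  By compactness, an orbit that stays close to \<open>p\<close> in
  one time direction then converges to it (\<open>stable_manifold_if_close\<close>,
  \<open>unstable_manifold_if_close\<close>).  So the shadowing orbit is homoclinic, and it remains to find the
  pseudo-orbits.  In all of them the time spent between the two visits to \<open>p\<close> must be a multiple of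
  the period \<open>k\<close>, because the stable and unstable sets of \<open>p\<close> see the phase along the orbit.

  If \<open>q \<noteq> p\<close>, follow the backward orbit of \<open>q\<close> out of \<open>p\<close> and continue forward.  By
  recurrence \<open>f\<^sup>n q\<close> is close to \<open>q\<close> for some large \<open>n\<close>, hence \<open>f\<^sup>n\<^sup>-\<^sup>m q\<close> is close to
  \<open>f\<^sup>-\<^sup>m q\<close>, which is close to \<open>p\<close> if \<open>m\<close> is a large multiple of \<open>k\<close>; there, jump to \<open>p\<close>.  Returns with \<open>n\<close> a
  multiple of \<open>k\<close> exist (\<open>recurrent_returns_dvd\<close>).  The shadowing point is close to \<open>q\<close>, so
  different from \<open>p\<close> (\<open>homoclinic_near_recurrent_unstable\<close>).

  If \<open>q = p\<close>, the orbit of \<open>q\<close> never leaves that of \<open>p\<close>, and the volume form provides chains that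
  do.  The set of points that can be reached from a point by \<open>\<delta>\<close>-chains is open and \<open>f\<close> maps its closure into itself.  Since \<open>f\<close>
  preserves a finite volume that is positive on open sets, such a set is open and closed.
  Therefore points of a connected set are joined by chains in both directions
  (\<open>connected_chain\<close>).  Chains from \<open>p\<close> to a nearby point off the orbit of \<open>p\<close> and back give
  one homoclinic point, whose images under \<open>f\<^sup>-\<^sup>k\<^sup>j\<close> are homoclinic and converge to \<open>p\<close>.

  Two analytic facts support this.  Isolation follows from a linear estimate: if \<open>L\<close> is
  hyperbolic, a bounded sequence with \<open>x\<^sub>j\<^sub>+\<^sub>1 - L x\<^sub>j\<close> of size at most \<open>e\<close> has size at most \<open>C e\<close>
  (\<open>hyperbolic_linear_bound\<close>).  The volume is integrated over finitely many chart pieces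
  (\<open>invariant_volume_exists\<close>); it is invariant by the change of variables formula, because an
  alternating form of top degree is multiplied by the determinant of the derivative.
\<close>

section \<open>Bounded pseudo-orbits of hyperbolic linear maps\<close>

lemma norm_vector_scalar_mult: "norm (c *s v) = cmod c * norm (v :: complex ^ 'n::finite)"
  by (simp add: norm_vec_def norm_mult L2_set_right_distrib)

definition complex_vec :: "real ^ 'n \<Rightarrow> real ^ 'n \<Rightarrow> complex ^ 'n::finite" where
  "complex_vec u w = (\<chi> i. Complex (u $ i) (w $ i))"

text \<open>
  The complex linear extension of a real linear map, which has the eigenvectors that the real map
  may lack.
\<close>

definition complexification :: "(real ^ 'n \<Rightarrow> real ^ 'n) \<Rightarrow> complex ^ 'n \<Rightarrow> complex ^ 'n::finite" where
  "complexification L z = complex_vec (L (\<chi> i. Re (z $ i))) (L (\<chi> i. Im (z $ i)))"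

lemma complex_vec_Re_Im [simp]: "complex_vec (\<chi> i. Re (z $ i)) (\<chi> i. Im (z $ i)) = z"
  by (simp add: complex_vec_def vec_eq_iff complex_eq_iff)

lemma complex_vec_eq_iff [simp]: "complex_vec u w = complex_vec u' w' \<longleftrightarrow> u = u' \<and> w = w'"
  by (auto simp: complex_vec_def vec_eq_iff)

lemma complex_vec_eq_0_iff: "complex_vec u w = 0 \<longleftrightarrow> u = 0 \<and> w = 0"
  by (auto simp: complex_vec_def vec_eq_iff complex_eq_iff)

lemma complexification_complex_vec: "complexification L (complex_vec u w) = complex_vec (L u) (L w)"
  by (simp add: complexification_def complex_vec_def)

lemma complex_vec_add: "complex_vec (u + u') (w + w') = complex_vec u w + complex_vec u' w'"
  by (simp add: complex_vec_def vec_eq_iff complex_eq_iff)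

lemma complex_vec_diff: "complex_vec (u - u') (w - w') = complex_vec u w - complex_vec u' w'"
  by (simp add: complex_vec_def vec_eq_iff complex_eq_iff)

lemma vector_scalar_mult_complex_vec:
  "c *s complex_vec u w = complex_vec (Re c *\<^sub>R u - Im c *\<^sub>R w) (Im c *\<^sub>R u + Re c *\<^sub>R w)"
  by (simp add: complex_vec_def vec_eq_iff complex_eq_iff)

lemma norm_complex_vec_0: "norm (complex_vec u 0) = norm (u :: real ^ 'n::finite)"
  by (simp add: complex_vec_def norm_vec_def complex_norm)

lemma complexification_add:
  assumes "linear L"
  shows "complexification L (x + y) = complexification L x + complexification L y"
proof -
  have "complexification L (complex_vec a b + complex_vec c d) =
        complexification L (complex_vec a b) + complexification L (complex_vec c d)" for a b c d
    by (simp add: complex_vec_add [symmetric] complexification_complex_vec linear_add [OF assms])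
  from this [of "\<chi> i. Re (x $ i)" "\<chi> i. Im (x $ i)" "\<chi> i. Re (y $ i)" "\<chi> i. Im (y $ i)"]
  show ?thesis by simp
qed

lemma complexification_scale:
  assumes "linear L"
  shows "complexification L (c *s x) = c *s complexification L x"
proof -
  have "complexification L (c *s complex_vec a b) = c *s complexification L (complex_vec a b)" for a b
    by (simp add: vector_scalar_mult_complex_vec complexification_complex_vec
        linear_add [OF assms] linear_diff [OF assms] linear_cmul [OF assms])
  from this [of "\<chi> i. Re (x $ i)" "\<chi> i. Im (x $ i)"] show ?thesis by simp
qed

text \<open>
  The polynomial \<open>P\<close> evaluated at the operator \<open>T\<close>, by Horner's scheme.
\<close>

definition op_poly ::
  "(complex ^ 'n \<Rightarrow> complex ^ 'n) \<Rightarrow> complex poly \<Rightarrow> complex ^ 'n \<Rightarrow> complex ^ 'n::finite" where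
  "op_poly T P = fold_coeffs (\<lambda>a F v. a *s v + F (T v)) P (\<lambda>_. 0)"

lemma op_poly_0 [simp]: "op_poly T 0 v = 0"
  by (simp add: op_poly_def)

lemma op_poly_pCons [simp]: "op_poly T (pCons a P) v = a *s v + op_poly T P (T v)"
  by (cases "a = 0 \<and> P = 0") (auto simp: op_poly_def)

lemma op_poly_add: "op_poly T (P + Q) v = op_poly T P v + op_poly T Q v"
  by (induction P Q arbitrary: v rule: poly_induct2) (simp_all add: vector_sadd_rdistrib algebra_simps)

lemma op_poly_smult: "op_poly T (smult c P) v = c *s op_poly T P v"
  by (induction P arbitrary: v) (simp_all add: vector_add_ldistrib vector_scalar_mult_def vec_eq_iff algebra_simps)

lemma op_poly_sum: "op_poly T (sum P I) v = (\<Sum>i\<in>I. op_poly T (P i) v)"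
  by (induction I rule: infinite_finite_induct) (simp_all add: op_poly_add)

lemma op_poly_monom: "op_poly T (monom c i) v = c *s (T ^^ i) v"
  by (induction i arbitrary: v) (simp_all add: monom_0 monom_Suc funpow_swap1)

lemma op_poly_linear:
  assumes "\<And>x y. T (x + y) = T x + T y" and "\<And>c x. T (c *s x) = c *s T x"
  shows "op_poly T P (c *s v + w) = c *s op_poly T P v + op_poly T P w"
proof (induction P arbitrary: v w)
  case (pCons a P)
  show ?case
    using pCons.IH [of "T v" "T w"]
    by (simp add: assms vector_add_ldistrib vector_smult_assoc algebra_simps mult.commute)
qed simp

lemma op_poly_commute:
  assumes "\<And>x y. T (x + y) = T x + T y" and "\<And>c x. T (c *s x) = c *s T x"
  shows "T (op_poly T P v) = op_poly T P (T v)"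
proof (induction P arbitrary: v)
  case 0
  show ?case using assms(2) [of 0 0] by simp
next
  case (pCons a P)
  then show ?case by (simp add: assms)
qed

lemma op_poly_diff:
  assumes "\<And>x y. T (x + y) = T x + T y" and "\<And>c x. T (c *s x) = c *s T x"
  shows "op_poly T P (w - c *s v) = op_poly T P w - c *s op_poly T P v"
proof -
  have "w - c *s v = (- c) *s v + w" by (simp add: vec_eq_iff)
  then show ?thesis by (simp only: op_poly_linear [OF assms]) simp
qed

lemma op_poly_root_factor:
  assumes "\<And>x y. T (x + y) = T x + T y" and "\<And>c x. T (c *s x) = c *s T x"
  shows "op_poly T ([:-\<mu>, 1:] * Q) v = op_poly T Q (T v - \<mu> *s v)"
proof -
  have "op_poly T ([:-\<mu>, 1:] * Q) v = (- \<mu>) *s op_poly T Q v + op_poly T Q (T v)"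
    by (simp add: op_poly_add op_poly_smult del: smult_minus_left)
  then show ?thesis by (simp add: op_poly_diff [OF assms])
qed

lemma matrix_sum_vector_mult:
  "(\<Sum>i\<in>I. M i) *v x = (\<Sum>i\<in>I. M i *v (x :: real ^ 'n::finite))"
  by (induction I rule: infinite_finite_induct) (simp_all add: matrix_vector_mult_add_rdistrib)

text \<open>
  The powers of \<open>L\<close> lie in the finite-dimensional space of matrices, so they are linearly dependent.
  One relation annihilates all vectors at once, which a relation between the images of a
  single vector would not do.
\<close>

lemma annihilating_poly_exists:
  fixes L :: "real ^ 'n::finite \<Rightarrow> real ^ 'n"
  assumes "linear L"
  obtains P where "P \<noteq> 0" "\<And>v. op_poly (complexification L) P v = 0"
proof -
  let ?T = "complexification L"
  define M where "M i = matrix (L ^^ i)" for i :: nat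
  have lin: "linear (L ^^ i)" for i
  proof (induction i)
    case (Suc i)
    then show ?case using linear_compose [OF Suc assms] by (simp add: o_def)
  qed (simp add: linear_id [unfolded id_def])
  have Mv: "M i *v x = (L ^^ i) x" for i x
    unfolding M_def by (rule fun_cong [OF matrix_vector_mul(2) [OF lin]])
  have pow: "(?T ^^ i) (complex_vec u w) = complex_vec ((L ^^ i) u) ((L ^^ i) w)" for i u w
    by (induction i) (simp_all add: complexification_complex_vec)
  show ?thesis
  proof (cases "inj M")
    case False
    then obtain i j where ij: "i \<noteq> j" "M i = M j"
      by (auto simp: inj_def)
    let ?P = "monom 1 i - monom 1 j :: complex poly"
    have "coeff ?P i \<noteq> 0" using ij by simp
    then have "?P \<noteq> 0" by (metis coeff_0)
    moreover have "op_poly ?T ?P v = 0" for v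
    proof -
      have "?P = monom 1 i + smult (-1) (monom 1 j)" by simp
      then have "op_poly ?T ?P v = (?T ^^ i) v - (?T ^^ j) v"
        by (simp only: op_poly_add op_poly_smult op_poly_monom) simp
      moreover have "(?T ^^ i) v = (?T ^^ j) v"
        using pow [of _ "\<chi> i. Re (v $ i)" "\<chi> i. Im (v $ i)"] Mv ij(2) by (metis complex_vec_Re_Im)
      ultimately show ?thesis by simp
    qed
    ultimately show ?thesis by (rule that)
  next
    case True
    let ?I = "{..DIM(real ^ 'n ^ 'n)}"
    have "card (M ` ?I) = card ?I"
      using True by (intro card_image) (auto intro: inj_on_subset)
    then have "dependent (M ` ?I)"
      by (intro dependent_biggerset) (simp del: DIM_cart)
    then obtain c i where i: "i \<in> ?I" "c (M i) \<noteq> 0" and c: "(\<Sum>v\<in>M ` ?I. c v *\<^sub>R v) = 0"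
      using dependent_finite [of "M ` ?I"] by blast
    let ?P = "\<Sum>i\<in>?I. monom (of_real (c (M i))) i :: complex poly"
    have "coeff ?P i = of_real (c (M i))"
      using i(1) by (simp add: coeff_sum)
    then have "?P \<noteq> 0" using i(2) by (metis coeff_0 of_real_eq_0_iff)
    moreover have "op_poly ?T ?P v = 0" for v
    proof -
      have z: "(\<Sum>i\<in>?I. c (M i) *\<^sub>R (L ^^ i) x) = 0" for x
      proof -
        have "(\<Sum>i\<in>?I. c (M i) *\<^sub>R (L ^^ i) x) = (\<Sum>i\<in>?I. (c (M i) *\<^sub>R M i) *v x)"
          by (simp only: Mv [symmetric] scaleR_matrix_vector_assoc)
        also have "\<dots> = (\<Sum>i\<in>?I. c (M i) *\<^sub>R M i) *v x"
          by (simp only: matrix_sum_vector_mult)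
        also have "(\<Sum>i\<in>?I. c (M i) *\<^sub>R M i) = (\<Sum>v\<in>M ` ?I. c v *\<^sub>R v)"
          using True by (subst sum.reindex) (auto intro: inj_on_subset)
        finally show ?thesis using c by simp
      qed
      have "op_poly ?T ?P (complex_vec u w) =
          complex_vec (\<Sum>i\<in>?I. c (M i) *\<^sub>R (L ^^ i) u) (\<Sum>i\<in>?I. c (M i) *\<^sub>R (L ^^ i) w)" for u w
        by (simp add: op_poly_sum op_poly_monom pow vector_scalar_mult_complex_vec)
          (simp add: complex_vec_def vec_eq_iff complex_eq_iff)
      from this [of "\<chi> i. Re (v $ i)" "\<chi> i. Im (v $ i)"] show ?thesis
        by (simp only: z complex_vec_Re_Im) (simp add: complex_vec_eq_0_iff)
    qed
    ultimately show ?thesis by (rule that)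
  qed
qed

text \<open>
  This is the linear estimate for multiplication by a number \<open>\<mu>\<close> off the unit circle.  Compare the supremum of
  \<open>norm (v j)\<close> with itself, one step forward if \<open>\<mu>\<close> contracts and one step backward if
  it expands.
\<close>

lemma scalar_hyperbolic_bound:
  fixes v :: "int \<Rightarrow> complex ^ 'n::finite"
  assumes bd: "\<And>j. norm (v j) \<le> K" and e: "\<And>j. norm (v (j + 1) - \<mu> *s v j) \<le> e"
    and \<mu>: "cmod \<mu> \<noteq> 1"
  shows "norm (v j) \<le> e / \<bar>1 - cmod \<mu>\<bar>"
proof -
  define s where "s = (SUP j. norm (v j))"
  have vs: "norm (v j) \<le> s" for j
    unfolding s_def by (rule cSUP_upper) (auto intro!: bdd_aboveI bd)
  have sle: "s \<le> b" if "\<And>j. norm (v j) \<le> b" for b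
    unfolding s_def by (rule cSUP_least) (auto intro: that)
  have "s * \<bar>1 - cmod \<mu>\<bar> \<le> e"
  proof (cases "cmod \<mu> < 1")
    case True
    have "norm (v j) \<le> cmod \<mu> * s + e" for j
    proof -
      have "norm (v j) \<le> norm (\<mu> *s v (j - 1)) + norm (v j - \<mu> *s v (j - 1))"
        by (metis add.commute norm_triangle_sub)
      also have "\<dots> \<le> cmod \<mu> * s + e"
        using e [of "j - 1"] vs [of "j - 1"]
        by (intro add_mono) (auto simp: norm_vector_scalar_mult mult_left_mono)
      finally show ?thesis .
    qed
    then have "s \<le> cmod \<mu> * s + e" by (rule sle)
    with True show ?thesis by (simp add: algebra_simps)
  next
    case False
    have "norm (v j) \<le> (s + e) / cmod \<mu>" for j
    proof -
      have "norm (\<mu> *s v j) \<le> norm (v (j + 1)) + norm (v (j + 1) - \<mu> *s v j)"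
        by (metis add.commute norm_minus_commute norm_triangle_sub)
      also have "\<dots> \<le> s + e"
        using e [of j] vs [of "j + 1"] by simp
      finally have "cmod \<mu> * norm (v j) \<le> s + e"
        by (simp add: norm_vector_scalar_mult)
      moreover have "cmod \<mu> > 0" using False by linarith
      ultimately show ?thesis
        by (simp add: pos_le_divide_eq mult.commute)
    qed
    then have "s \<le> (s + e) / cmod \<mu>" by (rule sle)
    moreover have gt1: "cmod \<mu> > 1" using False \<mu> by linarith
    moreover have "cmod \<mu> > 0" using gt1 by linarith
    ultimately have "s * cmod \<mu> \<le> s + e" by (simp only: pos_le_divide_eq)
    with gt1 show ?thesis by (simp add: algebra_simps)
  qed
  with \<mu> vs [of j] show ?thesis
    by (smt (verit) pos_le_divide_eq zero_less_abs_iff mult_right_mono)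
qed

text \<open>
  A root \<open>\<mu>\<close> of \<open>Q\<close> is split off and the induction hypothesis is applied to
  \<open>T (w j) - \<mu> *s w j\<close>.  The result says that \<open>w\<close> is nearly an orbit of multiplication by \<open>\<mu>\<close>,
  where the scalar estimate applies.
\<close>

lemma op_poly_hyperbolic_bound:
  fixes T :: "complex ^ 'n::finite \<Rightarrow> complex ^ 'n"
  assumes T: "\<And>x y. T (x + y) = T x + T y" "\<And>c x. T (c *s x) = c *s T x"
    and B: "B \<ge> 0" "\<And>x. norm (T x) \<le> B * norm x"
    and "Q \<noteq> 0" and "\<And>\<mu>. poly Q \<mu> = 0 \<Longrightarrow> cmod \<mu> \<noteq> 1"
  shows "\<exists>C\<ge>0. \<forall>w K e. (\<forall>j::int. norm (w j) \<le> K) \<longrightarrow> (\<forall>j. norm (w (j + 1) - T (w j)) \<le> e) \<longrightarrow>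
    (\<forall>j. norm (op_poly T Q (w j)) \<le> e) \<longrightarrow> (\<forall>j. norm (w j) \<le> C * e)"
  using assms(5,6)
proof (induction "degree Q" arbitrary: Q)
  case 0
  then obtain a where Q: "Q = [:a:]" by (metis degree_eq_zeroE)
  with 0 have a: "a \<noteq> 0" by simp
  show ?case
    by (rule exI [of _ "1 / cmod a"]) (use a in \<open>simp add: Q norm_vector_scalar_mult field_simps\<close>)
next
  case (Suc n)
  then have "\<not> constant (poly Q)" by (simp add: constant_degree)
  then obtain \<mu> where root: "poly Q \<mu> = 0" using fundamental_theorem_of_algebra by blast
  then obtain R where QR: "Q = [:-\<mu>, 1:] * R" by (metis dvdE poly_eq_0_iff_dvd)
  have "R \<noteq> 0" using QR Suc.prems(1) by auto
  then have "degree Q = Suc (degree R)" unfolding QR by (subst degree_mult_eq) auto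
  then have "n = degree R" using Suc.hyps(2) by simp
  moreover have "cmod \<nu> \<noteq> 1" if "poly R \<nu> = 0" for \<nu>
    using that Suc.prems(2) by (simp add: QR)
  ultimately obtain C where C: "C \<ge> 0" "\<And>w K e j. (\<forall>j::int. norm (w j) \<le> K) \<Longrightarrow>
      (\<forall>j. norm (w (j + 1) - T (w j)) \<le> e) \<Longrightarrow>
      (\<forall>j. norm (op_poly T R (w j)) \<le> e) \<Longrightarrow> norm (w j) \<le> C * e"
    using Suc.hyps(1) [of R] \<open>R \<noteq> 0\<close> by blast
  have \<mu>: "cmod \<mu> \<noteq> 1" using root Suc.prems(2) by blast
  define D where "D = B + cmod \<mu> + 1"
  have D: "D \<ge> 1" using B(1) by (simp add: D_def)
  let ?C = "(C * D + 1) / \<bar>1 - cmod \<mu>\<bar>"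
  have S_bound: "norm (T x - \<mu> *s x) \<le> (B + cmod \<mu>) * norm x" for x
    using norm_triangle_ineq4 [of "T x" "\<mu> *s x"] B(2) [of x]
    by (simp add: norm_vector_scalar_mult algebra_simps)
  have Tdiff: "T (x - y) = T x - T y" for x y
    using T(1) [of "x - y" y] by simp
  have "norm (w j) \<le> ?C * e"
    if K: "\<forall>j. norm (w j) \<le> K" and e: "\<forall>j. norm (w (j + 1) - T (w j)) \<le> e"
      and Q: "\<forall>j. norm (op_poly T Q (w j)) \<le> e" for w :: "int \<Rightarrow> complex ^ 'n" and K e j
  proof -
    define u where "u j = T (w j) - \<mu> *s w j" for j
    have e0: "0 \<le> e" using e norm_ge_zero order_trans by blast
    have "norm (u j) \<le> (B + cmod \<mu>) * K" for j
      unfolding u_def using K B(1)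
      by (intro order_trans [OF S_bound] mult_left_mono) auto
    moreover have "norm (u (j + 1) - T (u j)) \<le> D * e" for j
    proof -
      have "u (j + 1) - T (u j) = T (w (j + 1) - T (w j)) - \<mu> *s (w (j + 1) - T (w j))"
        by (simp add: u_def Tdiff T vector_ssub_ldistrib algebra_simps)
      then have "norm (u (j + 1) - T (u j)) \<le> (B + cmod \<mu>) * e"
        using S_bound [of "w (j + 1) - T (w j)"] e B(1)
        by (smt (verit) mult_left_mono norm_ge_zero)
      then show ?thesis using e0 by (simp add: D_def algebra_simps)
    qed
    moreover have "norm (op_poly T R (u j)) \<le> D * e" for j
    proof -
      have "op_poly T R (u j) = op_poly T Q (w j)"
        unfolding QR op_poly_root_factor [OF T] u_def ..
      then have "norm (op_poly T R (u j)) \<le> 1 * e" using Q by simp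
      also have "\<dots> \<le> D * e" using D e0 by (intro mult_right_mono) auto
      finally show ?thesis .
    qed
    ultimately have u: "norm (u j) \<le> C * (D * e)" for j
      using C(2) by blast
    have "norm (w (j + 1) - \<mu> *s w j) \<le> (C * D + 1) * e" for j
    proof -
      have "w (j + 1) - \<mu> *s w j = (w (j + 1) - T (w j)) + u j" by (simp add: u_def)
      then have "norm (w (j + 1) - \<mu> *s w j) \<le> e + C * (D * e)"
        using norm_triangle_ineq [of "w (j + 1) - T (w j)" "u j"] e u [of j] by (smt (verit))
      then show ?thesis by (simp add: algebra_simps)
    qed
    then have "norm (w j) \<le> ((C * D + 1) * e) / \<bar>1 - cmod \<mu>\<bar>"
      using K \<mu> by (intro scalar_hyperbolic_bound) auto
    then show ?thesis by simp
  qed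
  moreover have "?C \<ge> 0" using C(1) D by simp
  ultimately show ?case by blast
qed

text \<open>
  The roots of an annihilating polynomial of least degree are eigenvalues, hence off the unit circle,
  and its factors reduce the estimate to the scalar case.  The hypothesis on \<open>\<mu>\<close>, \<open>u\<close>, \<open>w\<close>
  says in real terms that \<open>u + \<i> w\<close> is an eigenvector of the complexification.
\<close>

lemma hyperbolic_linear_bound:
  fixes L :: "real ^ 'n::finite \<Rightarrow> real ^ 'n"
  assumes L: "linear L"
    and hyp: "\<And>\<mu> u w. u \<noteq> 0 \<or> w \<noteq> 0 \<Longrightarrow> L u = Re \<mu> *\<^sub>R u - Im \<mu> *\<^sub>R w \<Longrightarrow>
      L w = Im \<mu> *\<^sub>R u + Re \<mu> *\<^sub>R w \<Longrightarrow> cmod \<mu> \<noteq> 1"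
  shows "\<exists>C\<ge>0. \<forall>x K e. (\<forall>j::int. norm (x j) \<le> K) \<longrightarrow> (\<forall>j. norm (x (j + 1) - L (x j)) \<le> e) \<longrightarrow>
    (\<forall>j. norm (x j) \<le> C * e)"
proof -
  define T where "T = complexification L"
  have T: "T (x + y) = T x + T y" "T (c *s x) = c *s T x" for x y c
    by (simp_all add: T_def complexification_add [OF L] complexification_scale [OF L])
  have "linear T"
  proof
    show "T (r *\<^sub>R x) = r *\<^sub>R T x" for r x
      using T(2) [of "of_real r" x] by (simp add: vector_scalar_mult_def scaleR_vec_def scaleR_conv_of_real)
  qed (rule T)
  then obtain B where B: "B > 0" "\<And>x. norm (T x) \<le> B * norm x"
    using linear_bounded_pos by blast
  define ann where "ann P \<longleftrightarrow> P \<noteq> 0 \<and> (\<forall>v. op_poly T P v = 0)" for P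
  obtain P0 where P0: "P0 \<noteq> 0" "\<And>v. op_poly (complexification L) P0 v = 0"
    by (rule annihilating_poly_exists [OF L]) (rule that)
  then have "ann P0" by (simp add: ann_def T_def)
  then obtain P where P: "ann P" and min: "\<And>Q. ann Q \<Longrightarrow> degree P \<le> degree Q"
    using ex_has_least_nat [of ann P0 degree] by blast
  have roots: "cmod \<mu> \<noteq> 1" if root: "poly P \<mu> = 0" for \<mu>
  proof -
    obtain Q where PQ: "P = [:-\<mu>, 1:] * Q" using root by (metis dvdE poly_eq_0_iff_dvd)
    have P_ann: "P \<noteq> 0" "\<And>v. op_poly T P v = 0" using P by (simp_all add: ann_def)
    then have "Q \<noteq> 0" using PQ by (metis mult_zero_right)
    then have "degree P = Suc (degree Q)" unfolding PQ by (subst degree_mult_eq) auto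
    then have "\<not> ann Q" using min [of Q] by auto
    then obtain v where v: "op_poly T Q v \<noteq> 0" using \<open>Q \<noteq> 0\<close> by (auto simp: ann_def)
    define z where "z = op_poly T Q v"
    have "0 = op_poly T Q (T v - \<mu> *s v)"
      using P_ann(2) [of v] unfolding PQ op_poly_root_factor [OF T] by (rule sym)
    also have "\<dots> = T z - \<mu> *s z"
      by (simp add: z_def op_poly_diff [OF T] op_poly_commute [OF T])
    finally have Tz: "T z = \<mu> *s z" by simp
    define u w where "u = (\<chi> i. Re (z $ i))" and "w = (\<chi> i. Im (z $ i))"
    have z: "z = complex_vec u w" by (simp add: u_def w_def)
    have "u \<noteq> 0 \<or> w \<noteq> 0" using v z by (simp add: complex_vec_eq_0_iff z_def)
    moreover have "complex_vec (L u) (L w) =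
        complex_vec (Re \<mu> *\<^sub>R u - Im \<mu> *\<^sub>R w) (Im \<mu> *\<^sub>R u + Re \<mu> *\<^sub>R w)"
      using Tz by (simp only: z T_def complexification_complex_vec vector_scalar_mult_complex_vec)
    ultimately show ?thesis using hyp [of u w \<mu>] by simp
  qed
  have P_ann: "P \<noteq> 0" "\<And>v. op_poly T P v = 0" using P by (simp_all add: ann_def)
  have "\<exists>C\<ge>0. \<forall>w K e. (\<forall>j::int. norm (w j) \<le> K) \<longrightarrow> (\<forall>j. norm (w (j + 1) - T (w j)) \<le> e) \<longrightarrow>
      (\<forall>j. norm (op_poly T P (w j)) \<le> e) \<longrightarrow> (\<forall>j. norm (w j) \<le> C * e)"
    by (rule op_poly_hyperbolic_bound [OF T less_imp_le [OF B(1)] B(2) P_ann(1)]) (rule roots)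
  then obtain C where C0: "C \<ge> 0" and C: "\<forall>w K e. (\<forall>j::int. norm (w j) \<le> K) \<longrightarrow>
      (\<forall>j. norm (w (j + 1) - T (w j)) \<le> e) \<longrightarrow>
      (\<forall>j. norm (op_poly T P (w j)) \<le> e) \<longrightarrow> (\<forall>j. norm (w j) \<le> C * e)"
    by (elim exE conjE)
  show ?thesis
  proof (intro exI [of _ C] conjI C0 allI impI)
    fix x :: "int \<Rightarrow> real ^ 'n" and K e j
    assume K: "\<forall>j. norm (x j) \<le> K" and e: "\<forall>j. norm (x (j + 1) - L (x j)) \<le> e"
    have L0: "L 0 = 0" by (rule linear_0 [OF L])
    have "complex_vec (x (j + 1)) 0 - T (complex_vec (x j) 0) = complex_vec (x (j + 1) - L (x j)) 0" for j
      by (simp add: T_def complexification_complex_vec L0 flip: complex_vec_diff)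
    moreover have "0 \<le> e" using e norm_ge_zero order_trans by blast
    ultimately have "norm (complex_vec (x j) 0) \<le> C * e"
      using P_ann(2) K e by (intro C [rule_format, of _ K]) (simp_all add: norm_complex_vec_0)
    then show "norm (x j) \<le> C * e" by (simp add: norm_complex_vec_0)
  qed
qed

section \<open>Derivatives in charts\<close>

lemma is_chart_facts:
  assumes "is_chart c"
  shows "open (fst c)" and "open (snd c ` fst c)"
    and "continuous_on (fst c) (snd c)" and "continuous_on (snd c ` fst c) (chart_inv c)"
    and "x \<in> fst c \<Longrightarrow> chart_inv c (snd c x) = x"
    and "y \<in> snd c ` fst c \<Longrightarrow> chart_inv c y \<in> fst c"
    and "y \<in> snd c ` fst c \<Longrightarrow> snd c (chart_inv c y) = y"
  using assms unfolding is_chart_def homeomorphism_def by auto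

lemma chart_inv_tendsto:
  assumes "is_chart c" "x \<in> fst c"
  shows "(chart_inv c \<longlongrightarrow> x) (at (snd c x))"
proof -
  have "isCont (chart_inv c) (snd c x)"
    using is_chart_facts(2,4) [OF assms(1)] assms(2) by (simp add: continuous_on_eq_continuous_at)
  then show ?thesis
    using is_chart_facts(5) [OF assms] by (simp add: isCont_def)
qed

lemma eventually_in_chart_image:
  assumes "is_chart c" "x \<in> fst c" "isCont f x" "open U" "f x \<in> U"
  shows "eventually (\<lambda>y. y \<in> snd c ` fst c \<and> f (chart_inv c y) \<in> U) (at (snd c x))"
proof -
  have "(f \<longlongrightarrow> f x) (nhds x)"
    using assms(3) by (simp add: isCont_def tendsto_at_iff_tendsto_nhds)
  then have "((\<lambda>y. f (chart_inv c y)) \<longlongrightarrow> f x) (at (snd c x))"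
    using chart_inv_tendsto [OF assms(1,2)] by (rule filterlim_compose)
  then have "eventually (\<lambda>y. f (chart_inv c y) \<in> U) (at (snd c x))"
    using assms(4,5) by (rule topological_tendstoD)
  moreover have "eventually (\<lambda>y. y \<in> snd c ` fst c) (at (snd c x))"
    using is_chart_facts(2) [OF assms(1)] assms(2) by (intro eventually_at_in_open') auto
  ultimately show ?thesis by eventually_elim simp
qed

text \<open>
  The chain rule for coordinate expressions: \<open>local_rep c e (g \<circ> f)\<close> agrees with the
  composition through the intermediate chart \<open>d\<close> only near the base point, where \<open>f\<close> takes
  values in the domain of \<open>d\<close>.
\<close>

lemma has_derivative_local_rep_compose:
  assumes c: "is_chart c" "x \<in> fst c" and d: "is_chart d" "f x \<in> fst d" and f: "isCont f x"
    and F: "(local_rep c d f has_derivative F) (at (snd c x))"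
    and G: "(local_rep d e g has_derivative G) (at (snd d (f x)))"
  shows "(local_rep c e (g \<circ> f) has_derivative G \<circ> F) (at (snd c x))"
proof -
  have base: "local_rep c d f (snd c x) = snd d (f x)"
    by (simp add: local_rep_def is_chart_facts(5) [OF c])
  have "(local_rep d e g \<circ> local_rep c d f has_derivative G \<circ> F) (at (snd c x))"
    using F G by (intro diff_chain_at) (simp_all add: base)
  moreover have "eventually (\<lambda>y. (local_rep d e g \<circ> local_rep c d f) y = local_rep c e (g \<circ> f) y) (at (snd c x))"
    using eventually_in_chart_image [OF c f is_chart_facts(1) [OF d(1)] d(2)]
    by eventually_elim (simp add: local_rep_def is_chart_facts(5) [OF d(1)])
  ultimately show ?thesis
    by (rule has_derivative_transform_eventually)
      (simp_all add: local_rep_def is_chart_facts(5) [OF c] is_chart_facts(5) [OF d])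
qed

text \<open>
  Differentiability at a single point, in all charts.  It passes to the iterates of a map by the
  chain rule, without keeping track of continuity of the derivatives.
\<close>

definition chart_differentiable :: "('a::metric_space, 'n::finite) chart set \<Rightarrow> ('a \<Rightarrow> 'a) \<Rightarrow> 'a \<Rightarrow> bool" where
  "chart_differentiable A f x \<longleftrightarrow> isCont f x \<and>
     (\<forall>c\<in>charts_at A x. \<forall>d\<in>charts_at A (f x). local_rep c d f differentiable (at (snd c x)))"

abbreviation chart_deriv ::
  "('a::metric_space, 'n::finite) chart \<Rightarrow> ('a, 'n) chart \<Rightarrow> ('a \<Rightarrow> 'a) \<Rightarrow> 'a \<Rightarrow> real ^ 'n \<Rightarrow> real ^ 'n" where
  "chart_deriv c d f x \<equiv> frechet_derivative (local_rep c d f) (at (snd c x))"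

lemma chart_derivD:
  assumes "chart_differentiable A f x" "c \<in> charts_at A x" "d \<in> charts_at A (f x)"
  shows "(local_rep c d f has_derivative chart_deriv c d f x) (at (snd c x))"
  using assms unfolding chart_differentiable_def frechet_derivative_works by blast

context
  fixes A :: "('a::metric_space, 'n::finite) chart set" and r :: enat
  assumes atlas: "manifold_atlas r A"
begin

lemma atlas_charts: "c \<in> charts_at A x \<Longrightarrow> is_chart c" "c \<in> charts_at A x \<Longrightarrow> x \<in> fst c"
  using atlas unfolding manifold_atlas_def charts_at_def by blast+

lemma charts_at_nonempty: "\<exists>c. c \<in> charts_at A x"
proof -
  have "x \<in> (\<Union>c\<in>A. fst c)" using atlas unfolding manifold_atlas_def by blast
  then show ?thesis unfolding charts_at_def by blast
qed

lemma chart_differentiable_id: "chart_differentiable A id x"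
  unfolding chart_differentiable_def
proof (intro conjI ballI)
  fix c d assume "c \<in> charts_at A x" "d \<in> charts_at A (id x)"
  then have cd: "c \<in> A" "d \<in> A" "snd c x \<in> snd c ` (fst c \<inter> fst d)"
    by (auto simp: charts_at_def)
  have "enat 1 \<le> r" using atlas by (simp add: manifold_atlas_def one_enat_def)
  then have "Ck_on (Suc 0) (local_rep c d id) (snd c ` (fst c \<inter> fst d))"
    using atlas cd(1,2) unfolding manifold_atlas_def One_nat_def by blast
  then show "local_rep c d id differentiable at (snd c x)"
    unfolding Ck_on.simps using cd(3) by blast
qed (simp add: id_def)

lemma chart_differentiable_C1:
  assumes "C1_map A f"
  shows "chart_differentiable A f x"
  unfolding chart_differentiable_def
proof (intro conjI ballI)
  show "isCont f x"
    using assms by (simp add: C1_map_def continuous_on_eq_continuous_at)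
  fix c d assume "c \<in> charts_at A x" "d \<in> charts_at A (f x)"
  then have cd: "c \<in> A" "d \<in> A" "snd c x \<in> snd c ` (fst c \<inter> f -` fst d)"
    by (auto simp: charts_at_def)
  then have "Ck_on (Suc 0) (local_rep c d f) (snd c ` (fst c \<inter> f -` fst d))"
    using assms unfolding C1_map_def One_nat_def by blast
  then show "local_rep c d f differentiable at (snd c x)"
    unfolding Ck_on.simps using cd(3) by blast
qed

lemma chart_deriv_compose:
  assumes f: "chart_differentiable A f x" and g: "chart_differentiable A g (f x)"
    and c: "c \<in> charts_at A x" and d: "d \<in> charts_at A (f x)" and e: "e \<in> charts_at A (g (f x))"
  shows "(local_rep c e (g \<circ> f) has_derivative chart_deriv d e g (f x) \<circ> chart_deriv c d f x) (at (snd c x))"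
    and "chart_deriv c e (g \<circ> f) x w = chart_deriv d e g (f x) (chart_deriv c d f x w)"
proof -
  show *: "(local_rep c e (g \<circ> f) has_derivative chart_deriv d e g (f x) \<circ> chart_deriv c d f x) (at (snd c x))"
    using f atlas_charts [OF c] atlas_charts [OF d] chart_derivD [OF f c d] chart_derivD [OF g d e]
    by (intro has_derivative_local_rep_compose [where d = d]) (auto simp: chart_differentiable_def)
  show "chart_deriv c e (g \<circ> f) x w = chart_deriv d e g (f x) (chart_deriv c d f x w)"
    by (simp flip: frechet_derivative_at [OF *])
qed

lemma chart_differentiable_compose:
  assumes f: "chart_differentiable A f x" and g: "chart_differentiable A g (f x)"
  shows "chart_differentiable A (g \<circ> f) x"
proof -
  obtain d where "d \<in> charts_at A (f x)" using charts_at_nonempty by blast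
  then show ?thesis
    using assms chart_deriv_compose(1) [OF assms, of _ d] unfolding chart_differentiable_def
    by (metis comp_apply continuous_at_compose differentiable_def)
qed

lemma chart_differentiable_funpow:
  assumes "C1_map A f"
  shows "chart_differentiable A (f ^^ n) x"
proof (induction n)
  case 0
  show ?case using chart_differentiable_id by (simp add: id_def)
next
  case (Suc n)
  then show ?case
    by (simp only: funpow.simps) (rule chart_differentiable_compose [OF _ chart_differentiable_C1 [OF assms]])
qed

lemma chart_deriv_id_same:
  assumes "c \<in> charts_at A x"
  shows "chart_deriv c c id x w = w"
proof -
  note c = atlas_charts [OF assms]
  have "(local_rep c c id has_derivative (\<lambda>w. w)) (at (snd c x))"
  proof (rule has_derivative_transform_eventually [OF has_derivative_ident])
    show "eventually (\<lambda>y. y = local_rep c c id y) (at (snd c x))"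
      using eventually_in_chart_image [OF c continuous_ident open_UNIV UNIV_I]
      by (rule eventually_mono) (auto simp: local_rep_def is_chart_facts [OF c(1)])
  qed (use c in \<open>auto simp: local_rep_def is_chart_facts [OF c(1)]\<close>)
  then show ?thesis by (simp flip: frechet_derivative_at)
qed

lemma chart_deriv_id_cocycle:
  assumes "c \<in> charts_at A x" "d \<in> charts_at A x" "e \<in> charts_at A x"
  shows "chart_deriv d e id x (chart_deriv c d id x w) = chart_deriv c e id x w"
  using chart_deriv_compose(2) [OF chart_differentiable_id, of id x c d e w] chart_differentiable_id assms
  by simp

lemma chart_deriv_linear:
  assumes "chart_differentiable A f x" "c \<in> charts_at A x" "d \<in> charts_at A (f x)"
  shows "linear (chart_deriv c d f x)"
  using chart_derivD [OF assms] has_derivative_linear by blast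

lemma tvec_of_self: "c \<in> charts_at A x \<Longrightarrow> tvec_of A c x w c = w"
  by (simp add: tvec_of_def chart_deriv_id_same)

lemma tvec_of_in_tangent_space:
  assumes "c \<in> charts_at A x"
  shows "tvec_of A c x w \<in> tangent_space A x"
  using assms by (auto simp: tangent_space_def tvec_of_def chart_deriv_id_cocycle)

lemma tvec_of_component:
  assumes "v \<in> tangent_space A x" "c \<in> charts_at A x"
  shows "tvec_of A c x (v c) = v"
proof
  fix d
  show "tvec_of A c x (v c) d = v d"
  proof (cases "d \<in> charts_at A x")
    case True
    then have "v d = chart_deriv c d id x (v c)"
      using assms unfolding tangent_space_def by blast
    with True show ?thesis by (simp only: tvec_of_def if_True)
  next
    case False
    then have "v d = 0" using assms unfolding tangent_space_def by blast
    with False show ?thesis by (simp only: tvec_of_def if_False)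
  qed
qed

lemma tvec_of_linear_combination:
  assumes "c \<in> charts_at A x"
  shows "tvec_of A c x (a *\<^sub>R u + b *\<^sub>R v) = tlin a (tvec_of A c x u) b (tvec_of A c x v)"
proof
  fix d
  show "tvec_of A c x (a *\<^sub>R u + b *\<^sub>R v) d = tlin a (tvec_of A c x u) b (tvec_of A c x v) d"
  proof (cases "d \<in> charts_at A x")
    case True
    then have "linear (chart_deriv c d id x)"
      using chart_deriv_linear [OF chart_differentiable_id] assms by simp
    with True show ?thesis
      by (simp add: tvec_of_def tlin_def linear_add linear_cmul)
  qed (simp add: tvec_of_def tlin_def)
qed

text \<open>
  The tangent map can be computed in any pair of charts, whatever charts were selected in its
  definition: the cocycle identity for chart changes removes both choices.
\<close>

lemma tangent_map_tvec_of:
  assumes f: "chart_differentiable A f x" and c: "c \<in> charts_at A x" and d: "d \<in> charts_at A (f x)"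
  shows "tangent_map A f x (tvec_of A c x w) = tvec_of A d (f x) (chart_deriv c d f x w)"
proof -
  define c' where "c' = (SOME c. c \<in> charts_at A x)"
  define d' where "d' = (SOME d. d \<in> charts_at A (f x))"
  have c': "c' \<in> charts_at A x" unfolding c'_def by (rule someI_ex [OF charts_at_nonempty])
  have d': "d' \<in> charts_at A (f x)" unfolding d'_def by (rule someI_ex [OF charts_at_nonempty])
  note id = chart_differentiable_id
  have "tangent_map A f x (tvec_of A c x w) = tvec_of A d' (f x) (chart_deriv c' d' f x (chart_deriv c c' id x w))"
    by (simp add: tangent_map_def Let_def tvec_of_def c' flip: c'_def d'_def)
  also have "\<dots> = tvec_of A d' (f x) (chart_deriv c d' f x w)"
    using chart_deriv_compose(2) [OF id, of f x c c' d' w] f c c' d' by simp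
  also have "\<dots> = tvec_of A d' (f x) (chart_deriv d d' id (f x) (chart_deriv c d f x w))"
    using chart_deriv_compose(2) [of f x id c d d' w] f id c d d' by simp
  also have "\<dots> = tvec_of A d (f x) (chart_deriv c d f x w)"
    by (auto simp: tvec_of_def fun_eq_iff chart_deriv_id_cocycle d d')
  finally show ?thesis .
qed

end

section \<open>Hyperbolic periodic points are isolated\<close>

lemma iter_0 [simp]: "iter f 0 x = x"
  by (simp add: iter_def)

lemma iter_of_nat: "iter f (int n) = f ^^ n"
  by (simp add: iter_def)

lemma iter_minus_of_nat: "iter f (- int n) = inv f ^^ n"
  by (cases "n = 0") (auto simp: iter_def)

lemma iter_Suc:
  assumes "bij f"
  shows "iter f (i + 1) x = f (iter f i x)"
proof (cases "0 \<le> i")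
  case True
  then show ?thesis by (simp add: iter_def nat_add_distrib)
next
  case False
  define m where "m = nat (- i - 1)"
  have i: "i = - int (Suc m)" and i1: "i + 1 = - int m" using False by (simp_all add: m_def)
  show ?thesis
    unfolding i1 unfolding i iter_minus_of_nat
    using assms by (simp add: bij_is_surj surj_f_inv_f)
qed

lemma iter_add:
  assumes "bij f"
  shows "iter f (i + j) x = iter f i (iter f j x)"
proof (induction i rule: int_induct [where k = 0])
  case base
  show ?case by simp
next
  case (step1 i)
  then show ?case
    using iter_Suc [OF assms, of "i + j" x] iter_Suc [OF assms, of i "iter f j x"]
    by (simp add: algebra_simps)
next
  case (step2 i)
  have "f (iter f (i - 1 + j) x) = f (iter f (i - 1) (iter f j x))"
    using step2 iter_Suc [OF assms, of "i - 1 + j" x] iter_Suc [OF assms, of "i - 1" "iter f j x"]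
    by (simp add: algebra_simps)
  then show ?case using assms by (simp add: bij_is_inj inj_eq)
qed

lemma iter_inv:
  assumes "bij f"
  shows "iter (inv f) i = iter f (- i)"
  using assms by (cases "i = 0") (auto simp: iter_def inv_inv_eq)

lemma iter_funpow:
  assumes "bij f"
  shows "iter (f ^^ k) i = iter f (int k * i)"
proof (cases "0 \<le> i")
  case True
  then show ?thesis by (simp add: iter_def funpow_mult nat_mult_distrib)
next
  case False
  then have "iter (f ^^ k) i = inv (f ^^ k) ^^ nat (- i)" by (simp add: iter_def)
  also have "\<dots> = inv f ^^ (k * nat (- i))" by (simp add: inv_fn assms funpow_mult)
  also have "\<dots> = iter f (- int (k * nat (- i)))" by (simp only: iter_minus_of_nat)
  also have "- int (k * nat (- i)) = int k * i" using False by simp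
  finally show ?thesis .
qed

lemma iter_periodic:
  assumes "bij f" "(f ^^ k) p = p" "int k dvd i"
  shows "iter f i p = p"
proof -
  obtain j where j: "i = int k * j" using assms(3) by blast
  have "inv (f ^^ k) p = p"
    using assms by (metis bij_fn bij_is_inj inv_f_f)
  then have "(inv (f ^^ k) ^^ n) p = p" "((f ^^ k) ^^ n) p = p" for n
    using assms(2) by (induction n) simp_all
  then show ?thesis unfolding j iter_funpow [OF assms(1), symmetric] by (simp add: iter_def)
qed

text \<open>
  The number \<open>\<epsilon>\<close> is an expansivity constant of \<open>g\<close> at the fixed point \<open>p\<close>.
\<close>

definition isolated_fixed_point :: "('a::metric_space \<Rightarrow> 'a) \<Rightarrow> 'a \<Rightarrow> real \<Rightarrow> bool" where
  "isolated_fixed_point g p \<epsilon> \<longleftrightarrow> (\<forall>z. (\<forall>i. dist (iter g i z) p \<le> \<epsilon>) \<longrightarrow> z = p)"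

lemma isolated_fixed_point_inv:
  assumes "bij g" "isolated_fixed_point g p \<epsilon>"
  shows "isolated_fixed_point (inv g) p \<epsilon>"
  unfolding isolated_fixed_point_def iter_inv [OF assms(1)]
  using assms(2) unfolding isolated_fixed_point_def by (metis minus_minus)

text \<open>
  In a chart, a complete orbit close to \<open>p\<close> is a bounded sequence \<open>x\<close> with
  \<open>norm (x (j + 1) - L (x j)) \<le> \<eta> * norm (x j)\<close>, where \<open>L\<close> is the derivative and \<open>\<eta>\<close> is as small as
  desired.  With \<open>s\<close> the supremum of \<open>norm (x j)\<close>, the linear estimate gives \<open>s \<le> C * \<eta> * s\<close>, so
  \<open>s = 0\<close>.
\<close>

lemma hyperbolic_isolated:
  fixes A :: "('a::metric_space, 'n::finite) chart set"
  assumes atlas: "manifold_atlas r A" and f: "C1_diffeo A f" and hyp: "hyperbolic_periodic_point A f k p"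
  obtains \<epsilon> where "\<epsilon> > 0" "isolated_fixed_point (f ^^ k) p \<epsilon>"
proof -
  define g where "g = f ^^ k"
  have bij: "bij g" using f by (simp add: g_def C1_diffeo_def bij_fn)
  have gp: "g p = p" using hyp by (simp add: g_def hyperbolic_periodic_point_def)
  obtain c where c: "c \<in> charts_at A p" using charts_at_nonempty [OF atlas] by blast
  have chart: "is_chart c" and pc: "p \<in> fst c" using atlas_charts [OF atlas c] .
  have cdg: "chart_differentiable A g p"
    using chart_differentiable_funpow [OF atlas] f by (simp add: g_def C1_diffeo_def)
  have c': "c \<in> charts_at A (g p)" using c gp by simp
  define L where "L = chart_deriv c c g p"
  have der: "(local_rep c c g has_derivative L) (at (snd c p))"
    unfolding L_def by (rule chart_derivD [OF cdg c c'])
  have lin: "linear L" using der has_derivative_linear by blast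
  have tm: "tangent_map A g p (tvec_of A c p w) = tvec_of A c p (L w)" for w
    using tangent_map_tvec_of [OF atlas cdg c c'] gp by (simp add: L_def)
  have eig: "cmod \<mu> \<noteq> 1"
    if "u \<noteq> 0 \<or> w \<noteq> 0" and u: "L u = Re \<mu> *\<^sub>R u - Im \<mu> *\<^sub>R w" and w: "L w = Im \<mu> *\<^sub>R u + Re \<mu> *\<^sub>R w"
    for \<mu> u w
  proof -
    let ?u = "tvec_of A c p u" and ?w = "tvec_of A c p w"
    have "?u \<noteq> (\<lambda>_. 0) \<or> ?w \<noteq> (\<lambda>_. 0)"
      using that(1) tvec_of_self [OF atlas c] by metis
    moreover have "tangent_map A g p ?u = tlin (Re \<mu>) ?u (- Im \<mu>) ?w"
      unfolding tm u using tvec_of_linear_combination [OF atlas c, of "Re \<mu>" u "- Im \<mu>" w] by simp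
    moreover have "tangent_map A g p ?w = tlin (Im \<mu>) ?u (Re \<mu>) ?w"
      unfolding tm w by (rule tvec_of_linear_combination [OF atlas c])
    ultimately have "complex_eigenvalue (tangent_space A p) (tangent_map A g p) \<mu>"
      unfolding complex_eigenvalue_def using tvec_of_in_tangent_space [OF atlas c] by blast
    then show ?thesis using hyp by (simp add: hyperbolic_periodic_point_def g_def)
  qed
  have "\<exists>C\<ge>0. \<forall>x K e. (\<forall>j::int. norm (x j) \<le> K) \<longrightarrow> (\<forall>j. norm (x (j + 1) - L (x j)) \<le> e) \<longrightarrow>
      (\<forall>j. norm (x j) \<le> C * e)"
    by (rule hyperbolic_linear_bound [OF lin]) (rule eig)
  then obtain C where C: "C \<ge> 0" and bound: "\<forall>x K e. (\<forall>j::int. norm (x j) \<le> K) \<longrightarrow>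
      (\<forall>j. norm (x (j + 1) - L (x j)) \<le> e) \<longrightarrow> (\<forall>j. norm (x j) \<le> C * e)"
    by (elim exE conjE)
  define a where "a = snd c p"
  \<comment> \<open>The constant is chosen so that \<open>C * \<eta> \<le> 1 / 2\<close>.\<close>
  define \<eta> where "\<eta> = 1 / (2 * (C + 1))"
  have \<eta>: "\<eta> > 0" "C * \<eta> \<le> 1 / 2" using C by (auto simp: \<eta>_def field_simps)
  have ga: "local_rep c c g a = a"
    using gp by (simp add: a_def local_rep_def is_chart_facts(5) [OF chart pc])
  obtain \<delta> where \<delta>: "\<delta> > 0"
    "\<And>y. norm (y - a) < \<delta> \<Longrightarrow> norm (local_rep c c g y - a - L (y - a)) \<le> \<eta> * norm (y - a)"
  proof -
    from der [unfolded has_derivative_at_alt] \<eta>(1) obtain d where "d > 0"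
      "\<And>y. norm (y - a) < d \<Longrightarrow> norm (local_rep c c g y - local_rep c c g a - L (y - a)) \<le> \<eta> * norm (y - a)"
      unfolding a_def by blast
    then show thesis using that ga by simp
  qed
  let ?W = "fst c \<inter> snd c -` ball a \<delta>"
  have "open ?W"
    by (rule continuous_open_preimage) (use is_chart_facts [OF chart] in auto)
  moreover have "p \<in> ?W" using pc \<delta>(1) by (simp add: a_def)
  ultimately obtain \<epsilon>0 where \<epsilon>0: "\<epsilon>0 > 0" "ball p \<epsilon>0 \<subseteq> ?W"
    using openE by blast
  have "isolated_fixed_point g p (\<epsilon>0 / 2)"
    unfolding isolated_fixed_point_def
  proof (intro allI impI)
    fix z assume z: "\<forall>i. dist (iter g i z) p \<le> \<epsilon>0 / 2"
    have inW: "iter g i z \<in> ?W" for i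
    proof -
      have "dist p (iter g i z) < \<epsilon>0" using z [rule_format, of i] \<epsilon>0(1) by (simp add: dist_commute)
      then show ?thesis using \<epsilon>0(2) by auto
    qed
    define x where "x i = snd c (iter g i z) - a" for i
    have x\<delta>: "norm (x i) < \<delta>" for i
      using inW [of i] by (simp add: x_def dist_norm norm_minus_commute)
    define s where "s = (SUP i. norm (x i))"
    have xs: "norm (x i) \<le> s" for i
      unfolding s_def by (rule cSUP_upper) (auto intro!: bdd_aboveI2 less_imp_le x\<delta>)
    have step: "norm (x (j + 1) - L (x j)) \<le> \<eta> * s" for j
    proof -
      have "x (j + 1) = local_rep c c g (snd c (iter g j z)) - a"
        using inW [of j] by (simp add: x_def local_rep_def iter_Suc [OF bij] is_chart_facts(5) [OF chart])
      then have "norm (x (j + 1) - L (x j)) \<le> \<eta> * norm (x j)"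
        using \<delta>(2) [of "snd c (iter g j z)"] x\<delta> [of j] by (simp add: x_def)
      also have "\<dots> \<le> \<eta> * s" using xs \<eta>(1) by (simp add: mult_left_mono)
      finally show ?thesis .
    qed
    have "norm (x j) \<le> C * (\<eta> * s)" for j
      using bound [rule_format, of x s "\<eta> * s"] xs step by blast
    then have "s \<le> C * (\<eta> * s)" unfolding s_def by (intro cSUP_least) (auto simp: s_def)
    moreover have "0 \<le> s" using xs [of 0] norm_ge_zero order_trans by blast
    then have "C * (\<eta> * s) \<le> 1 / 2 * s"
      unfolding mult.assoc [symmetric] using \<eta>(2) by (rule mult_right_mono [rotated])
    ultimately have "s \<le> 0" by simp
    then have "norm (x 0) \<le> 0" using xs [of 0] by (rule order_trans [rotated])
    then have "x 0 = 0" by simp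
    then have "snd c z = snd c p" by (simp add: x_def a_def)
    then show "z = p"
      using inW [of 0] pc by (metis Int_iff chart is_chart_facts(5) iter_0)
  qed
  then show ?thesis using that [of "\<epsilon>0 / 2"] \<epsilon>0(1) by (simp add: g_def)
qed

locale compact_homeomorphism =
  fixes f :: "'a::metric_space \<Rightarrow> 'a"
  assumes compact_UNIV: "compact (UNIV :: 'a set)"
    and bij: "bij f" and cont: "continuous_on UNIV f" and cont_inv: "continuous_on UNIV (inv f)"
begin

lemma compact_homeomorphism_inv: "compact_homeomorphism (inv f)"
  using compact_UNIV bij cont cont_inv
  by unfold_locales (simp_all add: bij_imp_bij_inv inv_inv_eq)

lemma continuous_funpow: "continuous_on UNIV (f ^^ n)"
  by (induction n) (auto simp: id_def intro!: continuous_on_compose2 [OF cont])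

lemma continuous_inv_funpow: "continuous_on UNIV (inv f ^^ n)"
  by (induction n) (auto simp: id_def intro!: continuous_on_compose2 [OF cont_inv])

lemma compact_homeomorphism_funpow: "compact_homeomorphism (f ^^ n)"
  using compact_UNIV bij continuous_funpow continuous_inv_funpow
  by unfold_locales (simp_all add: bij_fn inv_fn)

lemma isCont_iter: "isCont (iter f i) x"
  using continuous_funpow continuous_inv_funpow
  by (auto simp: iter_def continuous_on_eq_continuous_at)

text \<open>
  A limit point of the forward orbit has a complete orbit in the closed \<open>\<epsilon>\<close>-ball, so it can only
  be \<open>p\<close>.
\<close>

lemma converges_to_isolated_fixed_point:
  assumes iso: "isolated_fixed_point f p \<epsilon>" and close: "\<And>n. n \<ge> N \<Longrightarrow> dist ((f ^^ n) y) p \<le> \<epsilon>"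
  shows "(\<lambda>n. (f ^^ n) y) \<longlonglongrightarrow> p"
proof (rule ccontr)
  assume "\<not> ?thesis"
  then obtain e where e: "e > 0" "\<forall>M. \<exists>n\<ge>M. dist ((f ^^ n) y) p \<ge> e"
    unfolding lim_sequentially by (meson not_less)
  then have inf: "infinite {n. dist ((f ^^ n) y) p \<ge> e}"
    by (simp add: infinite_nat_iff_unbounded_le)
  obtain r where r: "strict_mono r" "\<And>n::nat. dist ((f ^^ r n) y) p \<ge> e"
    using infinite_enumerate [OF inf] by blast
  have "\<forall>n. (f ^^ r n) y \<in> UNIV" by simp
  then obtain z s where s: "strict_mono s" "((\<lambda>n. (f ^^ r n) y) \<circ> s) \<longlonglongrightarrow> z"
    using compact_UNIV unfolding compact_def by blast
  have rs: "strict_mono (r \<circ> s)" by (rule strict_mono_o [OF r(1) s(1)])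
  have "dist (iter f i z) p \<le> \<epsilon>" for i
  proof (rule LIMSEQ_le_const2)
    have "(\<lambda>n. iter f i ((f ^^ r (s n)) y)) \<longlonglongrightarrow> iter f i z"
      using isCont_tendsto_compose [OF isCont_iter s(2)] by (simp add: o_def)
    then show "(\<lambda>n. dist (iter f i ((f ^^ r (s n)) y)) p) \<longlonglongrightarrow> dist (iter f i z) p"
      by (intro tendsto_intros)
    show "\<exists>M. \<forall>n\<ge>M. dist (iter f i ((f ^^ r (s n)) y)) p \<le> \<epsilon>"
    proof (intro exI allI impI)
      fix n assume n: "n \<ge> N + nat \<bar>i\<bar>"
      have "n \<le> r (s n)" using seq_suble [OF rs, of n] by simp
      then have m: "nat (i + int (r (s n))) \<ge> N" "i + int (r (s n)) \<ge> 0" using n by linarith+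
      have "iter f i ((f ^^ r (s n)) y) = iter f (i + int (r (s n))) y"
        by (simp add: iter_add [OF bij] iter_of_nat)
      also have "\<dots> = (f ^^ nat (i + int (r (s n)))) y"
        using m(2) by (simp add: iter_def)
      finally show "dist (iter f i ((f ^^ r (s n)) y)) p \<le> \<epsilon>" using close [OF m(1)] by simp
    qed
  qed
  then have "z = p" using iso by (simp add: isolated_fixed_point_def)
  moreover have "dist z p \<ge> e"
    by (rule LIMSEQ_le_const [OF tendsto_dist [OF s(2) tendsto_const]]) (auto intro: r(2))
  ultimately show False using e(1) by simp
qed

text \<open>
  Isolation yields convergence along the multiples of \<open>k\<close>; continuity of the first \<open>k\<close> iterates
  extends it to all times.
\<close>

lemma stable_manifold_if_close:
  assumes k: "k > 0" and p: "(f ^^ k) p = p" and iso: "isolated_fixed_point (f ^^ k) p \<epsilon>"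
    and close: "\<And>n. n \<ge> N \<Longrightarrow> dist ((f ^^ n) y) ((f ^^ n) p) \<le> \<epsilon>"
  shows "y \<in> stable_manifold f p"
proof -
  have per: "((f ^^ k) ^^ j) p = p" for j using p by (induction j) simp_all
  have "dist (((f ^^ k) ^^ j) y) p \<le> \<epsilon>" if "j \<ge> N" for j
  proof -
    have "k * j \<ge> N" using that k by (metis One_nat_def Suc_leI le_trans mult_le_mono1 nat_mult_1)
    then show ?thesis using close [of "k * j"] per [of j] by (simp add: funpow_mult)
  qed
  then have lim: "(\<lambda>j. ((f ^^ k) ^^ j) y) \<longlonglongrightarrow> p"
    by (rule compact_homeomorphism.converges_to_isolated_fixed_point [OF compact_homeomorphism_funpow iso])
  have "(\<lambda>n. dist ((f ^^ n) y) ((f ^^ n) p)) \<longlonglongrightarrow> 0"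
    unfolding tendsto_iff
  proof (intro allI impI)
    fix e :: real assume "e > 0"
    have "\<forall>\<rho>\<in>{..<k}. eventually (\<lambda>j. dist ((f ^^ \<rho>) (((f ^^ k) ^^ j) y)) ((f ^^ \<rho>) p) < e) sequentially"
    proof
      fix \<rho>
      have "isCont (f ^^ \<rho>) p" using continuous_funpow by (simp add: continuous_on_eq_continuous_at)
      then have "(\<lambda>j. (f ^^ \<rho>) (((f ^^ k) ^^ j) y)) \<longlonglongrightarrow> (f ^^ \<rho>) p"
        using lim by (rule isCont_tendsto_compose)
      then show "eventually (\<lambda>j. dist ((f ^^ \<rho>) (((f ^^ k) ^^ j) y)) ((f ^^ \<rho>) p) < e) sequentially"
        using \<open>e > 0\<close> by (rule tendstoD)
    qed
    then have "eventually (\<lambda>j. \<forall>\<rho>\<in>{..<k}. dist ((f ^^ \<rho>) (((f ^^ k) ^^ j) y)) ((f ^^ \<rho>) p) < e) sequentially"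
      by (rule eventually_ball_finite [OF finite_lessThan])
    then obtain J where J: "\<And>j \<rho>. j \<ge> J \<Longrightarrow> \<rho> < k \<Longrightarrow>
        dist ((f ^^ \<rho>) (((f ^^ k) ^^ j) y)) ((f ^^ \<rho>) p) < e"
      unfolding eventually_sequentially by blast
    show "eventually (\<lambda>n. dist (dist ((f ^^ n) y) ((f ^^ n) p)) 0 < e) sequentially"
      unfolding eventually_sequentially
    proof (intro exI allI impI)
      fix n assume "n \<ge> J * k"
      then have "n div k \<ge> J" using k by (simp add: less_eq_div_iff_mult_less_eq)
      moreover have "(f ^^ n) x = (f ^^ (n mod k)) (((f ^^ k) ^^ (n div k)) x)" for x
      proof -
        have "(f ^^ n) x = (f ^^ (n mod k + k * (n div k))) x" by simp
        then show ?thesis by (simp only: funpow_add funpow_mult o_apply)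
      qed
      ultimately show "dist (dist ((f ^^ n) y) ((f ^^ n) p)) 0 < e"
        using J [of "n div k" "n mod k"] k per by simp
    qed
  qed
  then show ?thesis by (simp add: stable_manifold_def)
qed

lemma unstable_manifold_if_close:
  assumes k: "k > 0" and p: "(f ^^ k) p = p" and iso: "isolated_fixed_point (f ^^ k) p \<epsilon>"
    and close: "\<And>n. n \<ge> N \<Longrightarrow> dist (iter f (- int n) y) (iter f (- int n) p) \<le> \<epsilon>"
  shows "y \<in> unstable_manifold f p"
proof -
  have "(inv f ^^ k) p = p"
    using iter_periodic [OF bij p, of "- int k"] by (simp add: iter_minus_of_nat)
  moreover have "isolated_fixed_point (inv f ^^ k) p \<epsilon>"
    using isolated_fixed_point_inv [OF bij_fn [OF bij] iso] by (simp add: inv_fn bij)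
  ultimately have "y \<in> stable_manifold (inv f) p"
    using close k
    by (intro compact_homeomorphism.stable_manifold_if_close [OF compact_homeomorphism_inv])
      (simp_all add: iter_minus_of_nat)
  then show ?thesis by (simp add: unstable_manifold_def stable_manifold_def)
qed

end

section \<open>Homoclinic points from shadowing\<close>

context compact_homeomorphism
begin

lemma recurrent_returns:
  assumes "recurrent_point f q" and "\<eta> > 0"
  shows "\<exists>n\<ge>B. dist ((f ^^ n) q) q < \<eta>"
proof -
  obtain s :: "nat \<Rightarrow> int" where s: "filterlim s at_top sequentially" "(\<lambda>j. iter f (s j) q) \<longlonglongrightarrow> q"
    using assms(1) by (auto simp: recurrent_point_def omega_limit_def)
  have "eventually (\<lambda>j. s j \<ge> int B) sequentially"
    using s(1) by (simp add: filterlim_at_top)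
  moreover have "eventually (\<lambda>j. dist (iter f (s j) q) q < \<eta>) sequentially"
    using s(2) assms(2) by (rule tendstoD)
  ultimately have "eventually (\<lambda>j. s j \<ge> int B \<and> dist (iter f (s j) q) q < \<eta>) sequentially"
    by (rule eventually_conj)
  then obtain j where j: "s j \<ge> int B" "dist (iter f (s j) q) q < \<eta>"
    by (auto simp: eventually_sequentially)
  then show ?thesis
    by (intro exI [of _ "nat (s j)"]) (auto simp: iter_def nat_le_iff)
qed

text \<open>
  Some residue class \<open>\<rho>\<close> modulo \<open>k\<close> contains arbitrarily late and arbitrarily close return times.
  Concatenating \<open>m\<close> of these returns gives times in the class of \<open>m * \<rho>\<close>, and \<open>m = k\<close> is the case
  wanted.
\<close>

lemma recurrent_returns_dvd:
  assumes q: "recurrent_point f q" and k: "k > 0" and "\<eta> > 0"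
  shows "\<exists>n\<ge>B. k dvd n \<and> dist ((f ^^ n) q) q < \<eta>"
proof -
  have "\<exists>\<rho><k. \<forall>\<eta>>0. \<forall>B. \<exists>n\<ge>B. n mod k = \<rho> \<and> dist ((f ^^ n) q) q < \<eta>"
  proof (rule ccontr)
    assume "\<not> ?thesis"
    then have "\<forall>\<rho>. \<exists>\<eta> B. \<rho> < k \<longrightarrow> \<eta> > 0 \<and> (\<forall>n\<ge>B. n mod k = \<rho> \<longrightarrow> \<not> dist ((f ^^ n) q) q < \<eta>)"
      by blast
    then obtain \<eta> B where *: "\<And>\<rho>. \<rho> < k \<Longrightarrow> \<eta> \<rho> > 0"
      "\<And>\<rho> n. \<rho> < k \<Longrightarrow> n \<ge> B \<rho> \<Longrightarrow> n mod k = \<rho> \<Longrightarrow> \<not> dist ((f ^^ n) q) q < (\<eta> \<rho> :: real)"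
      by metis
    have ne: "finite (\<eta> ` {..<k})" "\<eta> ` {..<k} \<noteq> {}" "finite (B ` {..<k})" using k by auto
    have "Min (\<eta> ` {..<k}) > 0" using * ne by simp
    then obtain n where n: "n \<ge> Max (B ` {..<k})" "dist ((f ^^ n) q) q < Min (\<eta> ` {..<k})"
      using recurrent_returns [OF q] by blast
    have \<rho>: "n mod k < k" using k by simp
    then have "B (n mod k) \<le> n" using n(1) ne(3) by (meson Max_ge imageI lessThan_iff order_trans)
    moreover have "Min (\<eta> ` {..<k}) \<le> \<eta> (n mod k)" using \<rho> ne(1) by (intro Min_le) auto
    ultimately show False using *(2) [OF \<rho>] n(2) by fastforce
  qed
  then obtain \<rho> where \<rho>: "\<And>\<eta> B. \<eta> > 0 \<Longrightarrow> \<exists>n\<ge>B. n mod k = \<rho> \<and> dist ((f ^^ n) q) q < \<eta>"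
    by blast
  have "\<exists>n\<ge>B. n mod k = (m * \<rho>) mod k \<and> dist ((f ^^ n) q) q < \<eta>" if "\<eta> > 0" "m > 0" for m \<eta> B
    using that(2,1)
  proof (induction m arbitrary: \<eta> B rule: nat_induct_non_zero)
    case 1
    then show ?case using \<rho> [of \<eta> B] by (metis mod_mod_trivial mult_1)
  next
    case (Suc m)
    obtain n1 where n1: "n1 mod k = \<rho>" "dist ((f ^^ n1) q) q < \<eta>"
      using \<rho> [OF Suc.prems, of 0] by blast
    have "((f ^^ n1) \<longlongrightarrow> (f ^^ n1) q) (at q)"
      using continuous_funpow [of n1] by (simp add: continuous_on_eq_continuous_at isCont_def)
    then have "((\<lambda>x. dist ((f ^^ n1) x) q) \<longlongrightarrow> dist ((f ^^ n1) q) q) (at q)"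
      by (intro tendsto_intros)
    then have "eventually (\<lambda>x. dist ((f ^^ n1) x) q < \<eta>) (at q)"
      using n1(2) by (rule order_tendstoD)
    then obtain d where d: "d > 0" "\<And>x. x \<noteq> q \<Longrightarrow> dist x q < d \<Longrightarrow> dist ((f ^^ n1) x) q < \<eta>"
      unfolding eventually_at by auto
    obtain n2 where n2: "n2 \<ge> B" "n2 mod k = (m * \<rho>) mod k" "dist ((f ^^ n2) q) q < d"
      using Suc.IH [OF d(1), of B] by blast
    have "dist ((f ^^ (n1 + n2)) q) q < \<eta>"
      using d(2) [OF _ n2(3)] n1(2) by (cases "(f ^^ n2) q = q") (auto simp: funpow_add)
    moreover have "(n1 + n2) mod k = (Suc m * \<rho>) mod k"
      using n1(1) n2(2) by (metis mod_add_eq mod_mod_trivial mult_Suc)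
    moreover have "n1 + n2 \<ge> B" using n2(1) by simp
    ultimately show ?case by blast
  qed
  from this [OF \<open>\<eta> > 0\<close> k] show ?thesis by (auto simp: dvd_eq_mod_eq_0)
qed

lemma stable_manifold_funpow_iff:
  assumes "(f ^^ m) p = p"
  shows "(f ^^ m) x \<in> stable_manifold f p \<longleftrightarrow> x \<in> stable_manifold f p"
proof -
  have "(f ^^ n) ((f ^^ m) x) = (f ^^ (n + m)) x" for n x by (simp add: funpow_add)
  from this [of _ x] this [of _ p] have
    "dist ((f ^^ n) ((f ^^ m) x)) ((f ^^ n) p) = dist ((f ^^ (n + m)) x) ((f ^^ (n + m)) p)" for n
    using assms by simp
  moreover have "(\<lambda>n. dist ((f ^^ (n + m)) x) ((f ^^ (n + m)) p)) \<longlonglongrightarrow> 0 \<longleftrightarrow>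
      (\<lambda>n. dist ((f ^^ n) x) ((f ^^ n) p)) \<longlonglongrightarrow> 0"
    by (rule iffI, rule LIMSEQ_offset [of _ m], assumption, rule LIMSEQ_ignore_initial_segment)
  ultimately show ?thesis
    by (simp only: stable_manifold_def mem_Collect_eq)
qed

end

locale isolated_periodic_point = compact_homeomorphism f for f :: "'a::metric_space \<Rightarrow> 'a" +
  fixes p :: 'a and k :: nat and \<epsilon>0 :: real
  assumes shadowing: "shadowing_property f"
    and k: "k > 0" and p: "(f ^^ k) p = p"
    and \<epsilon>0: "\<epsilon>0 > 0" and iso: "isolated_fixed_point (f ^^ k) p \<epsilon>0"
begin

text \<open>
  The pseudo-orbit is the orbit of \<open>q\<close> up to a multiple \<open>N\<close> of \<open>k\<close> at which \<open>f\<^sup>N q\<close> is close to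
  \<open>p\<close>, and the orbit of \<open>p\<close> from then on.  It comes from \<open>p\<close> because \<open>q\<close> lies in the unstable
  manifold.
\<close>

lemma homoclinic_near_recurrent_unstable:
  assumes q: "q \<in> unstable_manifold f p" "q \<noteq> p" and rec: "recurrent_point f q" and "e > 0"
  shows "\<exists>h\<in>homoclinic_points f p. dist h q < e"
proof -
  define \<epsilon> where "\<epsilon> = min e (min (\<epsilon>0 / 2) (dist q p))"
  have \<epsilon>: "\<epsilon> > 0" "\<epsilon> \<le> e" "\<epsilon> \<le> \<epsilon>0 / 2" "\<epsilon> \<le> dist q p" using \<epsilon>0 q(2) \<open>e > 0\<close> by (auto simp: \<epsilon>_def)
  obtain \<delta> where \<delta>: "\<delta> > 0" "\<And>x. pseudo_orbit f \<delta> x \<Longrightarrow> \<exists>y. shadowed_by f \<epsilon> x y"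
    using shadowing \<epsilon>(1) unfolding shadowing_property_def by blast
  have past: "\<exists>M. \<forall>m\<ge>M. dist (iter f (- int m) q) (iter f (- int m) p) < d" if "d > 0" for d
    using q(1) that unfolding unstable_manifold_def lim_sequentially by (simp add: iter_minus_of_nat)
  obtain M where M: "\<And>m. m \<ge> M \<Longrightarrow> dist (iter f (- int m) q) (iter f (- int m) p) < \<delta> / 2"
    using past [of "\<delta> / 2"] \<delta>(1) by auto
  \<comment> \<open>The point of the backward orbit at which to come back to \<open>p\<close>; a multiple of \<open>k\<close>, so that
    \<open>u\<close> is close to \<open>p\<close> itself and not to another point of its orbit.\<close>
  define u where "u = iter f (- int (k * M)) q"
  have "k * M \<ge> M" using k by (cases k) auto
  then have u: "dist u p < \<delta> / 2"
    using M [of "k * M"] iter_periodic [OF bij p, of "- int (k * M)"] by (simp add: u_def)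
  have "isCont (iter f (- int (k * M))) q" by (rule isCont_iter)
  then obtain \<eta> where \<eta>: "\<eta> > 0" "\<And>x. dist x q < \<eta> \<Longrightarrow> dist (iter f (- int (k * M)) x) u < \<delta> / 2"
    using \<delta>(1) unfolding continuous_at_eps_delta u_def by (metis half_gt_zero)
  obtain n where n: "n \<ge> k * M + 1" "k dvd n" "dist ((f ^^ n) q) q < \<eta>"
    using recurrent_returns_dvd [OF rec k \<eta>(1)] by blast
  define N where "N = int n - int (k * M)"
  have N: "N > 0" "int k dvd N" using n by (auto simp: N_def simp flip: of_nat_mult)
  have Np: "iter f N p = p" by (rule iter_periodic [OF bij p N(2)])
  have "iter f N q = iter f (- int (k * M)) ((f ^^ n) q)"
    using iter_add [OF bij, of "- int (k * M)" "int n" q] by (simp add: N_def iter_of_nat)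
  then have "dist (iter f N q) u < \<delta> / 2" using \<eta>(2) n(3) by simp
  then have jump: "dist (iter f N q) p < \<delta>"
    using u by (metis dist_commute dist_triangle_half_r)
  define x where "x i = (if i < N then iter f i q else iter f i p)" for i
  have "pseudo_orbit f \<delta> x"
    unfolding pseudo_orbit_def
  proof
    fix i
    consider "i + 1 < N" | "i + 1 = N" | "i \<ge> N" by linarith
    then show "dist (x (i + 1)) (f (x i)) < \<delta>"
    proof cases
      case 2
      then have "f (x i) = iter f N q" "x (i + 1) = p"
        using iter_Suc [OF bij, of i q] Np by (simp_all add: x_def)
      then show ?thesis using jump by (simp add: dist_commute)
    qed (use \<delta>(1) in \<open>simp_all add: x_def iter_Suc [OF bij]\<close>)
  qed
  then obtain y where y: "\<And>i. dist (x i) (iter f i y) < \<epsilon>"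
    using \<delta>(2) unfolding shadowed_by_def by blast
  have "dist q y < \<epsilon>" using y [of 0] N(1) by (simp add: x_def)
  moreover from this have "y \<noteq> p" using \<epsilon>(4) by auto
  moreover have "y \<in> stable_manifold f p"
  proof (rule stable_manifold_if_close [OF k p iso])
    fix m assume "m \<ge> nat N"
    then have "x (int m) = (f ^^ m) p" by (simp add: x_def iter_of_nat nat_le_iff)
    then show "dist ((f ^^ m) y) ((f ^^ m) p) \<le> \<epsilon>0"
      using y [of "int m"] \<epsilon>(3) \<epsilon>0 by (simp add: dist_commute iter_of_nat)
  qed
  moreover have "y \<in> unstable_manifold f p"
  proof -
    obtain M' where M': "\<And>m. m \<ge> M' \<Longrightarrow> dist (iter f (- int m) q) (iter f (- int m) p) < \<epsilon>0 / 2"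
      using past [of "\<epsilon>0 / 2"] \<epsilon>0 by auto
    show ?thesis
    proof (rule unstable_manifold_if_close [OF k p iso])
      fix m assume m: "m \<ge> M'"
      have "dist (iter f (- int m) q) (iter f (- int m) y) < \<epsilon>0 / 2"
        using y [of "- int m"] N(1) \<epsilon>(3) by (simp add: x_def)
      then show "dist (iter f (- int m) y) (iter f (- int m) p) \<le> \<epsilon>0"
        using M' [OF m] by (metis dist_triangle_half_r less_imp_le)
    qed
  qed
  ultimately show ?thesis
    using \<epsilon>(2) by (intro bexI [of _ y]) (auto simp: homoclinic_points_def dist_commute)
qed

end

definition chain_step :: "('a::metric_space \<Rightarrow> 'a) \<Rightarrow> real \<Rightarrow> 'a rel" where
  "chain_step f \<delta> = {(a, b). dist (f a) b < \<delta>}"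

context isolated_periodic_point
begin

text \<open>
  The orbit of \<open>p\<close> is interrupted by a closed chain through \<open>x0\<close>.  The shadowing orbit is homoclinic, and it
  is not the orbit of \<open>p\<close> because it comes close to \<open>x0\<close>.  Running through the closed chain \<open>k\<close>
  times makes its length a multiple of \<open>k\<close>.
\<close>

lemma homoclinic_from_chains:
  assumes chains: "\<And>\<delta>. \<delta> > 0 \<Longrightarrow> (p, x0) \<in> (chain_step f \<delta>)\<^sup>* \<and> (x0, p) \<in> (chain_step f \<delta>)\<^sup>*"
    and x0: "\<And>j. x0 \<noteq> (f ^^ j) p"
  shows "\<exists>y. y \<in> homoclinic_points f p"
proof -
  have per: "(f ^^ j) p = (f ^^ (j mod k)) p" for j
    by (rule funpow_mod_eq [symmetric, OF p])
  have "finite ((\<lambda>j. (f ^^ j) p) ` {..<k})" by simp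
  from finite_set_avoid [OF this, of x0] obtain d where
    d: "d > 0" "\<And>x. x \<in> (\<lambda>j. (f ^^ j) p) ` {..<k} \<Longrightarrow> x \<noteq> x0 \<Longrightarrow> d \<le> dist x0 x" by blast
  have d': "d \<le> dist x0 ((f ^^ j) p)" for j
    using d(2) [of "(f ^^ (j mod k)) p"] per [of j] x0 k by (metis imageI lessThan_iff mod_less_divisor)
  define \<epsilon> where "\<epsilon> = min \<epsilon>0 d"
  have \<epsilon>: "\<epsilon> > 0" "\<epsilon> \<le> \<epsilon>0" "\<epsilon> \<le> d" using \<epsilon>0 d(1) by (auto simp: \<epsilon>_def)
  obtain \<delta> where \<delta>: "\<delta> > 0" "\<And>x. pseudo_orbit f \<delta> x \<Longrightarrow> \<exists>y. shadowed_by f \<epsilon> x y"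
    using shadowing \<epsilon>(1) unfolding shadowing_property_def by blast
  let ?R = "chain_step f \<delta>"
  obtain a b where a: "(p, x0) \<in> ?R ^^ a" and b: "(x0, p) \<in> ?R ^^ b"
    using chains [OF \<delta>(1)] by (auto simp: rtrancl_power)
  have loop: "(p, p) \<in> ?R ^^ (a + b)" using a b by (auto simp: relpow_add)
  have loops: "(p, p) \<in> ?R ^^ ((a + b) * m)" for m
    using loop by (induction m) (auto simp: relpow_add)
  obtain \<phi> where \<phi>: "\<phi> 0 = p" "\<phi> a = x0" "\<forall>i<a. (\<phi> i, \<phi> (Suc i)) \<in> ?R"
    using a by (auto simp: relpow_fun_conv)
  \<comment> \<open>With \<open>k - 1\<close> further rounds the closed chain has total length \<open>k * (a + b)\<close>.\<close>
  define l where "l = b + (a + b) * (k - 1)"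
  have "(x0, p) \<in> ?R ^^ l" using b loops by (auto simp: relpow_add l_def)
  then obtain \<psi> where \<psi>: "\<psi> 0 = x0" "\<psi> l = p" "\<forall>i<l. (\<psi> i, \<psi> (Suc i)) \<in> ?R"
    by (auto simp: relpow_fun_conv)
  define K where "K = a + l"
  have K: "K = k * (a + b)"
  proof -
    obtain k' where "k = Suc k'" using k gr0_conv_Suc by blast
    then show ?thesis by (simp add: K_def l_def algebra_simps)
  qed
  have Kp: "iter f (int K) p = p" by (rule iter_periodic [OF bij p]) (simp add: K)
  define x where "x i = (if i < 0 then iter f i p else if i < int a then \<phi> (nat i)
      else if i < int K then \<psi> (nat i - a) else iter f i p)" for i
  have x_neg: "x i = iter f i p" if "i \<le> 0" for i
    using that \<phi>(1,2) \<psi>(1,2) Kp by (cases "a = 0"; cases "l = 0") (auto simp: x_def K_def)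
  have x_\<phi>: "x (int i) = \<phi> i" if "i \<le> a" for i
    using that \<phi>(2) \<psi>(1,2) Kp by (cases "l = 0") (auto simp: x_def K_def le_less)
  have x_\<psi>: "x (int a + int i) = \<psi> i" if "i \<le> l" for i
  proof (cases "i = l")
    case True
    then show ?thesis using Kp \<psi>(2) by (simp add: x_def K_def)
  qed (use that in \<open>auto simp: x_def K_def nat_int_add\<close>)
  have x_pos: "x i = iter f i p" if "i \<ge> int K" for i
    using that by (simp add: x_def K_def)
  have "pseudo_orbit f \<delta> x"
    unfolding pseudo_orbit_def
  proof
    fix i
    consider "i < 0" | "0 \<le> i" "i < int a" | "int a \<le> i" "i < int K" | "i \<ge> int K" by linarith
    then show "dist (x (i + 1)) (f (x i)) < \<delta>"
    proof cases
      case 1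
      then show ?thesis using \<delta>(1) by (simp add: x_neg iter_Suc [OF bij])
    next
      case 2
      define j where "j = nat i"
      have j: "i = int j" "j < a" using 2 by (auto simp: j_def)
      then have "x i = \<phi> j" "x (i + 1) = \<phi> (Suc j)" using x_\<phi> [of j] x_\<phi> [of "Suc j"] by (auto simp: add.commute)
      then show ?thesis using \<phi>(3) j(2) by (simp add: chain_step_def dist_commute)
    next
      case 3
      define j where "j = nat (i - int a)"
      have j: "i = int a + int j" "j < l" using 3 by (auto simp: j_def K_def)
      then have "x i = \<psi> j" "x (i + 1) = \<psi> (Suc j)" using x_\<psi> [of j] x_\<psi> [of "Suc j"] by (auto simp: ac_simps)
      then show ?thesis using \<psi>(3) j(2) by (simp add: chain_step_def dist_commute)
    next
      case 4
      then show ?thesis using \<delta>(1) by (simp add: x_pos iter_Suc [OF bij])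
    qed
  qed
  then obtain y where y: "\<And>i. dist (x i) (iter f i y) < \<epsilon>"
    using \<delta>(2) unfolding shadowed_by_def by blast
  have "y \<noteq> p"
  proof
    assume "y = p"
    then have "dist x0 ((f ^^ a) p) < \<epsilon>" using y [of "int a"] x_\<phi> [of a] \<phi>(2) by (simp add: iter_of_nat)
    then show False using d' [of a] \<epsilon>(3) by simp
  qed
  moreover have "y \<in> stable_manifold f p"
  proof (rule stable_manifold_if_close [OF k p iso])
    fix m assume "m \<ge> K"
    then have "x (int m) = (f ^^ m) p" by (simp add: x_pos iter_of_nat)
    then show "dist ((f ^^ m) y) ((f ^^ m) p) \<le> \<epsilon>0"
      using y [of "int m"] \<epsilon>(2) by (simp add: dist_commute iter_of_nat)
  qed
  moreover have "y \<in> unstable_manifold f p"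
  proof (rule unstable_manifold_if_close [OF k p iso])
    fix m :: nat assume "m \<ge> 0"
    show "dist (iter f (- int m) y) (iter f (- int m) p) \<le> \<epsilon>0"
      using y [of "- int m"] \<epsilon>(2) x_neg [of "- int m"] by (simp add: dist_commute)
  qed
  ultimately show ?thesis by (auto simp: homoclinic_points_def)
qed

text \<open>
  The backward iterates of a homoclinic point at multiples of the period are homoclinic and converge
  to \<open>p\<close>.
\<close>

lemma homoclinic_sequence_to_periodic_point:
  assumes y: "y \<in> homoclinic_points f p"
  shows "\<exists>h. (\<forall>j. h j \<in> homoclinic_points f p) \<and> h \<longlonglongrightarrow> p"
proof -
  define h where "h j = (inv f ^^ (k * j)) y" for j
  interpret inv: compact_homeomorphism "inv f" by (rule compact_homeomorphism_inv)
  have invp: "(inv f ^^ (k * j)) p = p" for j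
    using iter_periodic [OF bij p, of "- int (k * j)"] unfolding iter_minus_of_nat by simp
  have fp: "(f ^^ (k * j)) p = p" for j
    using iter_periodic [OF bij p, of "int (k * j)"] unfolding iter_of_nat by simp
  have fh: "(f ^^ (k * j)) (h j) = y" for j
    unfolding h_def by (simp add: bij bij_is_surj surj_f_inv_f inv_fn [symmetric] bij_fn)
  have "h j \<in> homoclinic_points f p" for j
  proof -
    have "h j \<in> stable_manifold f p"
      using y fh [of j] stable_manifold_funpow_iff [OF fp, of j "h j"] by (simp add: homoclinic_points_def)
    moreover have "h j \<in> stable_manifold (inv f) p"
      using y inv.stable_manifold_funpow_iff [OF invp, of j y]
      by (simp add: homoclinic_points_def h_def unstable_manifold_def stable_manifold_def)
    moreover have "h j \<noteq> p" using y fh [of j] fp [of j] by (auto simp: homoclinic_points_def)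
    ultimately show ?thesis
      by (simp add: homoclinic_points_def unstable_manifold_def stable_manifold_def)
  qed
  moreover have "h \<longlonglongrightarrow> p"
  proof -
    have "(\<lambda>n. dist ((inv f ^^ n) y) ((inv f ^^ n) p)) \<longlonglongrightarrow> 0"
      using y by (simp add: homoclinic_points_def unstable_manifold_def)
    moreover have "strict_mono (\<lambda>j. k * j)" using k by (simp add: strict_mono_def)
    ultimately have "((\<lambda>n. dist ((inv f ^^ n) y) ((inv f ^^ n) p)) \<circ> (\<lambda>j. k * j)) \<longlonglongrightarrow> 0"
      by (rule LIMSEQ_subseq_LIMSEQ)
    then have "(\<lambda>j. dist (h j) p) \<longlonglongrightarrow> 0"
      by (simp only: o_def h_def invp)
    then show ?thesis by (subst tendsto_dist_iff)
  qed
  ultimately show ?thesis by blast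
qed

end

section \<open>Invariant volumes and chain connectedness\<close>

text \<open>
  Finite additivity is enough for the argument below, so \<open>\<mu>\<close> is kept as a plain set function.
\<close>

locale invariant_volume = compact_homeomorphism f for f :: "'a::metric_space \<Rightarrow> 'a" +
  fixes \<mu> :: "'a set \<Rightarrow> real"
  assumes volume_nonneg: "0 \<le> \<mu> E"
    and volume_Un: "E \<in> sets borel \<Longrightarrow> F \<in> sets borel \<Longrightarrow> E \<inter> F = {} \<Longrightarrow> \<mu> (E \<union> F) = \<mu> E + \<mu> F"
    and volume_invariant: "E \<in> sets borel \<Longrightarrow> \<mu> (f ` E) = \<mu> E"
    and volume_open_pos: "open U \<Longrightarrow> U \<noteq> {} \<Longrightarrow> 0 < \<mu> U"
begin

text \<open>
  Since \<open>f ` R\<close> has the volume of \<open>R\<close> and lies in the closed set \<open>f ` closure R\<close>, the open set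
  \<open>R - f ` closure R\<close> has volume 0 and is empty.
\<close>

lemma trapping_region_clopen:
  assumes R: "open R" and trap: "f ` closure R \<subseteq> R"
  shows "closed R" and "f ` R = R"
proof -
  let ?C = "f ` closure R"
  have "compact (closure R)" using compact_Int_closed [OF compact_UNIV closed_closure] by simp
  then have "compact ?C"
    using cont by (intro compact_continuous_image continuous_on_subset [OF cont]) auto
  then have C: "closed ?C" by (rule compact_imp_closed)
  have fR: "open (f ` R)"
  proof -
    have "f ` R = inv f -` R"
      using bij_vimage_eq_inv_image [OF bij_imp_bij_inv [OF bij], of R] by (simp add: inv_inv_eq bij)
    then show ?thesis using open_vimage [OF R cont_inv] by simp
  qed
  have sub: "f ` R \<subseteq> ?C" using closure_subset by blast
  have borel: "f ` R \<in> sets borel" "?C \<in> sets borel" "R \<in> sets borel" using R C fR by auto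
  have "?C = f ` R \<union> (?C - f ` R)" using sub by blast
  then have "\<mu> ?C = \<mu> (f ` R) + \<mu> (?C - f ` R)"
    using volume_Un [of "f ` R" "?C - f ` R"] borel by (metis Diff_disjoint sets.Diff)
  moreover have "R = ?C \<union> (R - ?C)" using trap by blast
  then have "\<mu> R = \<mu> ?C + \<mu> (R - ?C)"
    using volume_Un [of ?C "R - ?C"] borel by (metis Diff_disjoint sets.Diff)
  ultimately have "\<mu> (R - ?C) \<le> 0"
    using volume_invariant [OF borel(3)] volume_nonneg [of "?C - f ` R"] by linarith
  moreover have "open (R - ?C)" using R C by (rule open_Diff)
  ultimately have "R - ?C = {}" using volume_open_pos by (meson not_less)
  then have eq: "?C = R" using trap by blast
  with C show "closed R" by simp
  then have "closure R = R" by (rule closure_closed)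
  with eq show "f ` R = R" by simp
qed

text \<open>
  The set of points reachable from \<open>x\<close> by \<open>\<delta>\<close>-chains is open, and a chain to a point near \<open>w\<close>
  can be continued to \<open>f w\<close>; so it is a trapping region, hence open and closed.  It contains \<open>x\<close>
  itself, because it contains \<open>f x\<close> and equals its image.
\<close>

lemma connected_chain:
  assumes "\<delta> > 0" and X: "connected X" "x \<in> X" "y \<in> X"
  shows "(x, y) \<in> (chain_step f \<delta>)\<^sup>+"
proof -
  define R where "R = (chain_step f \<delta>)\<^sup>+ `` {x}"
  have R_step: "b \<in> R" if "a \<in> R" "dist (f a) b < \<delta>" for a b
    using that by (auto simp: R_def chain_step_def intro: trancl_into_trancl)
  have "R = (\<Union>z\<in>(chain_step f \<delta>)\<^sup>* `` {x}. ball (f z) \<delta>)"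
    by (auto simp: R_def trancl_unfold_right chain_step_def)
  then have openR: "open R" by auto
  have trap: "f ` closure R \<subseteq> R"
  proof
    fix v assume "v \<in> f ` closure R"
    then obtain w where w: "w \<in> closure R" "v = f w" by blast
    have "isCont f w" using cont by (simp add: continuous_on_eq_continuous_at)
    then obtain d where d: "d > 0" "\<And>w'. dist w' w < d \<Longrightarrow> dist (f w') (f w) < \<delta>"
      using \<open>\<delta> > 0\<close> unfolding continuous_at_eps_delta by blast
    obtain w' where "w' \<in> R" "dist w' w < d" using w(1) d(1) closure_approachable by blast
    then show "v \<in> R" using d(2) w(2) R_step by blast
  qed
  note clopen = trapping_region_clopen [OF openR trap]
  have "f x \<in> R" using \<open>\<delta> > 0\<close> by (auto simp: R_def chain_step_def)
  then have "f x \<in> f ` R" by (simp only: clopen(2))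
  then have "x \<in> R" using bij_is_inj [OF bij] by (simp only: inj_image_mem_iff)
  then have "X \<subseteq> R"
    using connectedD [OF X(1) openR open_Compl [OF clopen(1)]] X(2) by blast
  then show ?thesis using X(3) by (auto simp: R_def)
qed

end

section \<open>Alternating forms, determinants and change of variables\<close>

text \<open>
  Both sides are multiplicative in the matrix, so elementary matrices suffice.  Quantifying over
  all families \<open>b\<close> is what makes the induction work for products.
\<close>

lemma alternating_multilinear_det:
  fixes \<phi> :: "('n::finite \<Rightarrow> 'v::real_vector) \<Rightarrow> real" and M :: "real ^ 'n ^ 'n"
  assumes lin: "\<And>v i a x b y. \<phi> (v(i := a *\<^sub>R x + b *\<^sub>R y)) = a * \<phi> (v(i := x)) + b * \<phi> (v(i := y))"
    and alt: "\<And>v i j. i \<noteq> j \<Longrightarrow> v i = v j \<Longrightarrow> \<phi> v = 0"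
  shows "\<phi> (\<lambda>i. \<Sum>j\<in>UNIV. M $ i $ j *\<^sub>R b j) = det M * \<phi> b"
proof -
  have scale: "\<phi> (v(i := a *\<^sub>R x)) = a * \<phi> (v(i := x))" for v i a x
    using lin [of v i a x 0 0] by simp
  have add: "\<phi> (v(i := x + y)) = \<phi> (v(i := x)) + \<phi> (v(i := y))" for v i x y
    using lin [of v i 1 x 1 y] by simp
  have "\<forall>b. \<phi> (\<lambda>i. \<Sum>j\<in>UNIV. M $ i $ j *\<^sub>R b j) = det M * \<phi> b"
  proof (induction M rule: induct_matrix_elementary)
    case (1 A B)
    show ?case
    proof
      fix b :: "'n \<Rightarrow> 'v"
      have "(\<Sum>j\<in>UNIV. (A ** B) $ i $ j *\<^sub>R b j) = (\<Sum>k\<in>UNIV. A $ i $ k *\<^sub>R (\<Sum>j\<in>UNIV. B $ k $ j *\<^sub>R b j))" for i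
        by (simp add: matrix_matrix_mult_def scaleR_sum_left scaleR_sum_right) (rule sum.swap)
      then show "\<phi> (\<lambda>i. \<Sum>j\<in>UNIV. (A ** B) $ i $ j *\<^sub>R b j) = det (A ** B) * \<phi> b"
        by (simp add: 1 det_mul)
    qed
  next
    case (2 A i)
    show ?case
    proof
      fix b :: "'n \<Rightarrow> 'v"
      let ?v = "\<lambda>i. \<Sum>j\<in>UNIV. A $ i $ j *\<^sub>R b j"
      have "?v i = 0" using 2 by (simp add: row_def vec_eq_iff)
      then have "?v(i := 0 *\<^sub>R 0) = ?v" by (intro ext) simp
      moreover have "det A = 0" using 2 by (rule det_zero_row)
      ultimately show "\<phi> ?v = det A * \<phi> b" using scale [of ?v i 0 0] by simp
    qed
  next
    case (3 A)
    show ?case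
    proof
      fix b :: "'n \<Rightarrow> 'v"
      have "\<phi> (\<lambda>i. if i \<in> S then A $ i $ i *\<^sub>R b i else b i) = (\<Prod>i\<in>S. A $ i $ i) * \<phi> b" if "finite S" for S
        using that
      proof (induction S)
        case (insert k S)
        let ?v = "\<lambda>i. if i \<in> S then A $ i $ i *\<^sub>R b i else b i"
        have "(\<lambda>i. if i \<in> insert k S then A $ i $ i *\<^sub>R b i else b i) = ?v(k := A $ k $ k *\<^sub>R b k)"
          by auto
        moreover have "?v(k := b k) = ?v" using insert.hyps by auto
        ultimately show ?case using insert scale [of ?v k "A $ k $ k" "b k"] by simp
      qed simp
      from this [of UNIV] have "\<phi> (\<lambda>i. A $ i $ i *\<^sub>R b i) = det A * \<phi> b"
        using det_diagonal [of A] 3 by simp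
      moreover have "(\<Sum>j\<in>UNIV. A $ i $ j *\<^sub>R b j) = A $ i $ i *\<^sub>R b i" for i
      proof -
        have "(\<Sum>j\<in>UNIV. A $ i $ j *\<^sub>R b j) = (\<Sum>j\<in>{i}. A $ i $ j *\<^sub>R b j)"
          using 3 by (intro sum.mono_neutral_right) auto
        then show ?thesis by simp
      qed
      ultimately show "\<phi> (\<lambda>i. \<Sum>j\<in>UNIV. A $ i $ j *\<^sub>R b j) = det A * \<phi> b" by simp
    qed
  next
    case (4 m n)
    let ?A = "\<chi> i j. mat 1 $ i $ Transposition.transpose m n j :: real ^ 'n ^ 'n"
    show ?case
    proof
      fix b :: "'n \<Rightarrow> 'v"
      have "det ?A = of_int (sign (Transposition.transpose m n)) * det (mat 1 :: real ^ 'n ^ 'n)"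
        by (rule det_permute_columns) (simp add: permutes_swap_id)
      then have det: "det ?A = - 1" using 4 by (simp add: sign_swap_id)
      have v: "(\<Sum>j\<in>UNIV. ?A $ i $ j *\<^sub>R b j) = b (Transposition.transpose m n i)" for i
      proof -
        have "(\<Sum>j\<in>UNIV. ?A $ i $ j *\<^sub>R b j) = (\<Sum>j\<in>UNIV. if j = Transposition.transpose m n i then b j else 0)"
          by (intro sum.cong) (auto simp: mat_def)
        then show ?thesis by simp
      qed
      \<comment> \<open>Expanding the vanishing value at equal entries \<open>b m + b n\<close> gives the sign of a swap.\<close>
      let ?w = "\<lambda>x y. b(m := x, n := y)"
      let ?s = "b m + b n"
      have m_add: "\<phi> (?w ?s x) = \<phi> (?w (b m) x) + \<phi> (?w (b n) x)" for x
      proof -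
        have "b(n := x, m := z) = ?w z x" for z by (rule fun_upd_twist) (use 4 in simp)
        then show ?thesis using add [of "b(n := x)" m "b m" "b n"] by simp
      qed
      have "0 = \<phi> (?w ?s ?s)" using alt [of m n "?w ?s ?s"] 4 by simp
      also have "\<dots> = \<phi> (?w ?s (b m)) + \<phi> (?w ?s (b n))" by (rule add)
      also have "\<dots> = \<phi> (?w (b m) (b n)) + \<phi> (?w (b n) (b m))"
        unfolding m_add using alt [of m n "?w (b m) (b m)"] alt [of m n "?w (b n) (b n)"] 4 by simp
      also have "?w (b m) (b n) = b" by auto
      also have "?w (b n) (b m) = (\<lambda>i. b (Transposition.transpose m n i))"
        using 4 by (auto simp: Transposition.transpose_def)
      finally have "\<phi> (\<lambda>i. b (Transposition.transpose m n i)) = - \<phi> b" by simp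
      then show "\<phi> (\<lambda>i. \<Sum>j\<in>UNIV. ?A $ i $ j *\<^sub>R b j) = det ?A * \<phi> b"
        unfolding v det by simp
    qed
  next
    case (5 m n c)
    let ?A = "\<chi> i j. if i = m \<and> j = n then c else of_bool (i = j) :: real ^ 'n ^ 'n"
    show ?case
    proof
      fix b :: "'n \<Rightarrow> 'v"
      have "?A = (\<chi> k. if k = m then row m (mat 1) + c *s row n (mat 1) else row k (mat 1))"
        using 5 by (auto simp: vec_eq_iff row_def mat_def)
      then have det: "det ?A = 1" using det_row_operation [OF 5, of "mat 1" c] by simp
      have v: "(\<lambda>i. \<Sum>j\<in>UNIV. ?A $ i $ j *\<^sub>R b j) = b(m := 1 *\<^sub>R b m + c *\<^sub>R b n)"
      proof
        fix i
        have "(\<Sum>j\<in>UNIV. ?A $ i $ j *\<^sub>R b j) =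
            (\<Sum>j\<in>UNIV. (if j = i then b j else 0) + (if i = m \<and> j = n then c *\<^sub>R b j else 0))"
          using 5 by (intro sum.cong) auto
        also have "\<dots> = b i + (\<Sum>j\<in>UNIV. if i = m \<and> j = n then c *\<^sub>R b j else 0)"
          by (simp add: sum.distrib)
        also have "\<dots> = (b(m := 1 *\<^sub>R b m + c *\<^sub>R b n)) i" by (cases "i = m") simp_all
        finally show "(\<Sum>j\<in>UNIV. ?A $ i $ j *\<^sub>R b j) = (b(m := 1 *\<^sub>R b m + c *\<^sub>R b n)) i" .
      qed
      have "\<phi> (b(m := b n)) = 0" using alt [of m n "b(m := b n)"] 5 by simp
      then show "\<phi> (\<lambda>i. \<Sum>j\<in>UNIV. ?A $ i $ j *\<^sub>R b j) = det ?A * \<phi> b"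
        unfolding v det lin by simp
    qed
  qed
  then show ?thesis by blast
qed

text \<open>
  A copy of a finite type, with a well-order pulled back from an injection into the natural numbers.
  Renaming coordinates by it preserves Lebesgue measure and determinants, and so carries the change
  of variables formula from well-ordered index types over to all finite ones.
\<close>

typedef 'n wo_copy = "UNIV :: 'n set" ..

instance wo_copy :: (finite) finite
proof
  show "finite (UNIV :: 'a wo_copy set)"
    by (subst type_definition.Abs_image [OF type_definition_wo_copy, symmetric]) simp
qed

definition wo_rank :: "'n::finite wo_copy \<Rightarrow> nat" where
  "wo_rank = (SOME r. inj r)"

lemma inj_wo_rank: "inj (wo_rank :: 'n::finite wo_copy \<Rightarrow> nat)"
proof -
  have "\<exists>r :: 'n wo_copy \<Rightarrow> nat. inj r"
    using finite_imp_inj_to_nat_seg [OF finite [of UNIV]] by blast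
  then show ?thesis unfolding wo_rank_def by (rule someI_ex)
qed

instantiation wo_copy :: (finite) wellorder
begin

definition "x \<le> y \<longleftrightarrow> wo_rank x \<le> wo_rank y"
definition "x < y \<longleftrightarrow> wo_rank x < wo_rank y"

instance
proof
  fix x y z :: "'a wo_copy"
  show "x < y \<longleftrightarrow> x \<le> y \<and> \<not> y \<le> x" "x \<le> x" "x \<le> y \<or> y \<le> x"
    by (auto simp: less_eq_wo_copy_def less_wo_copy_def)
  show "x \<le> z" if "x \<le> y" "y \<le> z"
    using that by (simp add: less_eq_wo_copy_def)
  show "x = y" if "x \<le> y" "y \<le> x"
  proof (rule injD [OF inj_wo_rank])
    show "wo_rank x = wo_rank y" using that by (simp add: less_eq_wo_copy_def)
  qed
next
  fix P and a :: "'a wo_copy"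
  assume step: "\<And>x. (\<And>y. y < x \<Longrightarrow> P y) \<Longrightarrow> P (x :: 'a wo_copy)"
  show "P a"
  proof (induction a rule: measure_induct_rule [of wo_rank])
    case (less a)
    show ?case by (rule step, rule less.IH) (simp add: less_wo_copy_def)
  qed
qed

end

definition to_wo :: "real ^ 'n \<Rightarrow> real ^ 'n wo_copy" where
  "to_wo v = (\<chi> i. v $ Rep_wo_copy i)"

definition of_wo :: "real ^ 'n wo_copy \<Rightarrow> real ^ 'n" where
  "of_wo w = (\<chi> i. w $ Abs_wo_copy i)"

lemma of_to_wo [simp]: "of_wo (to_wo v) = v" and to_of_wo [simp]: "to_wo (of_wo w) = w"
  by (simp_all add: of_wo_def to_wo_def Abs_wo_copy_inverse Rep_wo_copy_inverse)

lemma linear_to_wo: "linear (to_wo :: real ^ 'n::finite \<Rightarrow> _)"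
  by (rule linearI) (simp_all add: to_wo_def vec_eq_iff)

lemma linear_of_wo: "linear (of_wo :: _ \<Rightarrow> real ^ 'n::finite)"
  by (rule linearI) (simp_all add: of_wo_def vec_eq_iff)

lemma borel_measurable_to_wo [measurable]: "(to_wo :: real ^ 'n::finite \<Rightarrow> _) \<in> borel_measurable borel"
  by (intro borel_measurable_continuous_onI linear_continuous_on linear_conv_bounded_linear [THEN iffD1] linear_to_wo)

lemma borel_measurable_of_wo [measurable]: "(of_wo :: _ \<Rightarrow> real ^ 'n::finite) \<in> borel_measurable borel"
  by (intro borel_measurable_continuous_onI linear_continuous_on linear_conv_bounded_linear [THEN iffD1] linear_of_wo)

lemma bij_Rep_wo_copy: "bij (Rep_wo_copy :: 'n wo_copy \<Rightarrow> 'n)"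
  by (rule bijI') (auto simp: Rep_wo_copy_inject intro: Abs_wo_copy_inverse [symmetric])

lemma prod_Basis_cart: "(\<Prod>b\<in>Basis. (v :: real ^ 'n::finite) \<bullet> b) = (\<Prod>i\<in>UNIV. v $ i)"
proof -
  have B: "(Basis :: (real ^ 'n) set) = (\<lambda>i. axis i 1) ` UNIV" by (auto simp: Basis_vec_def)
  show ?thesis unfolding B
    by (subst prod.reindex) (auto simp: inj_on_def axis_eq_axis inner_axis)
qed

lemma distr_lborel_to_wo: "distr lborel borel (to_wo :: real ^ 'n::finite \<Rightarrow> _) = lborel"
proof (rule lborel_eqI [symmetric])
  fix l u :: "real ^ 'n wo_copy"
  assume le: "\<And>b. b \<in> Basis \<Longrightarrow> l \<bullet> b \<le> u \<bullet> b"
  have comp: "l $ i \<le> u $ i" for i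
    using le [of "axis i 1"] by (simp add: inner_axis axis_in_Basis_iff)
  have pre: "to_wo -` box l u = (box (of_wo l) (of_wo u) :: (real ^ 'n) set)"
  proof -
    have "(\<forall>i. l $ i < v $ Rep_wo_copy i \<and> v $ Rep_wo_copy i < u $ i) \<longleftrightarrow>
        (\<forall>i. l $ Abs_wo_copy i < v $ i \<and> v $ i < u $ Abs_wo_copy i)" for v :: "real ^ 'n"
      by (metis Abs_wo_copy_inverse Rep_wo_copy_inverse UNIV_I)
    then show ?thesis by (auto simp: mem_box_cart to_wo_def of_wo_def)
  qed
  have "emeasure (distr lborel borel to_wo) (box l u) = emeasure lborel (box (of_wo l) (of_wo u) :: (real ^ 'n) set)"
    by (simp add: emeasure_distr pre)
  also have "\<dots> = (\<Prod>b\<in>Basis. (of_wo u - of_wo l :: real ^ 'n) \<bullet> b)"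
  proof (rule emeasure_lborel_box)
    fix b :: "real ^ 'n" assume "b \<in> Basis"
    then obtain i where "b = axis i 1" by (auto simp: Basis_vec_def)
    then show "of_wo l \<bullet> b \<le> of_wo u \<bullet> b" using comp by (simp add: inner_axis of_wo_def)
  qed
  also have "(\<Prod>b\<in>Basis. (of_wo u - of_wo l :: real ^ 'n) \<bullet> b) = (\<Prod>i\<in>UNIV. (u - l) $ Abs_wo_copy i)"
    by (simp add: prod_Basis_cart of_wo_def)
  also have "\<dots> = (\<Prod>i\<in>UNIV. (u - l) $ i)"
    by (rule prod.reindex_bij_betw [of Abs_wo_copy UNIV UNIV "\<lambda>i. (u - l) $ i"])
      (metis bij_Rep_wo_copy Abs_wo_copy_inverse Rep_wo_copy_inverse UNIV_I bijI' )
  finally show "emeasure (distr lborel borel (to_wo :: real ^ 'n \<Rightarrow> _)) (box l u) = (\<Prod>b\<in>Basis. (u - l) \<bullet> b)"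
    by (simp add: prod_Basis_cart)
qed simp

lemma lborel_integral_of_wo:
  fixes h :: "real ^ 'n::finite \<Rightarrow> real"
  assumes [measurable]: "h \<in> borel_measurable borel"
  shows "integrable lborel (\<lambda>w. h (of_wo w)) \<longleftrightarrow> integrable lborel h"
    and "(LINT w|lborel. h (of_wo w)) = (LINT v|lborel. h v)"
proof -
  show "integrable lborel (\<lambda>w. h (of_wo w)) \<longleftrightarrow> integrable lborel h"
    by (subst distr_lborel_to_wo [symmetric], subst integrable_distr_eq) auto
  show "(LINT w|lborel. h (of_wo w)) = (LINT v|lborel. h v)"
    by (subst distr_lborel_to_wo [symmetric], subst integral_distr) auto
qed

text \<open>
  The determinant of a matrix with renamed indices is again alternating and multilinear in the rows
  and is 1 at the identity, which characterizes the determinant.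
\<close>

lemma det_to_wo:
  fixes L :: "real ^ 'n::finite \<Rightarrow> real ^ 'n"
  shows "det (matrix (to_wo \<circ> L \<circ> of_wo)) = det (matrix L)"
proof -
  define \<phi> :: "('n \<Rightarrow> real ^ 'n) \<Rightarrow> real" where "\<phi> v = det (\<chi> i. to_wo (v (Rep_wo_copy i)))" for v
  have "\<phi> (\<lambda>i. \<Sum>j\<in>UNIV. matrix L $ i $ j *\<^sub>R axis j 1) = det (matrix L) * \<phi> (\<lambda>j. axis j 1)"
  proof (rule alternating_multilinear_det)
    fix v :: "'n \<Rightarrow> real ^ 'n" and i j :: 'n and a b and x y :: "real ^ 'n"
    have upd: "(\<chi> l. to_wo ((v(i := z)) (Rep_wo_copy l))) =
        (\<chi> l. if l = Abs_wo_copy i then to_wo z else to_wo (v (Rep_wo_copy l)))" for z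
      by (auto simp: vec_eq_iff Abs_wo_copy_inverse Rep_wo_copy_inverse)
    have lin: "to_wo (a *\<^sub>R x + b *\<^sub>R y) = a *s to_wo x + b *s to_wo y"
      by (simp add: linear_add [OF linear_to_wo] linear_cmul [OF linear_to_wo] scalar_mult_eq_scaleR)
    show "\<phi> (v(i := a *\<^sub>R x + b *\<^sub>R y)) = a * \<phi> (v(i := x)) + b * \<phi> (v(i := y))"
      unfolding \<phi>_def upd lin
      by (simp only: det_row_add [of "Abs_wo_copy i" "\<lambda>_. a *s to_wo x" "\<lambda>_. b *s to_wo y"]
          det_row_mul [of "Abs_wo_copy i" _ "\<lambda>_. to_wo x"] det_row_mul [of "Abs_wo_copy i" _ "\<lambda>_. to_wo y"])
    show "\<phi> v = 0" if "i \<noteq> j" "v i = v j"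
      unfolding \<phi>_def
      by (rule det_identical_rows [of "Abs_wo_copy i" "Abs_wo_copy j"])
        (use that in \<open>simp_all add: Abs_wo_copy_inject Abs_wo_copy_inverse row_def\<close>)
  qed
  moreover have "(\<lambda>i. \<Sum>j\<in>UNIV. matrix L $ i $ j *\<^sub>R axis j 1) = (\<lambda>i. matrix L $ i)"
    by (rule ext) (simp add: vec_eq_iff axis_def if_distrib cong: if_cong)
  moreover have "\<phi> (\<lambda>i. matrix L $ i) = det (matrix (to_wo \<circ> L \<circ> of_wo))"
  proof -
    have ax: "of_wo (axis j 1) = axis (Rep_wo_copy j) 1" for j :: "'n wo_copy"
      by (auto simp: of_wo_def axis_def vec_eq_iff Abs_wo_copy_inverse Rep_wo_copy_inverse)
    show ?thesis
      by (auto simp: \<phi>_def matrix_def to_wo_def ax intro!: arg_cong [of _ _ det])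
  qed
  moreover have "\<phi> (\<lambda>j. axis j 1) = 1"
  proof -
    have "(\<chi> i. to_wo (axis (Rep_wo_copy i) 1)) = (mat 1 :: real ^ 'n wo_copy ^ 'n wo_copy)"
      by (auto simp: vec_eq_iff to_wo_def axis_def mat_def Rep_wo_copy_inject)
    then show ?thesis by (simp add: \<phi>_def)
  qed
  ultimately show ?thesis by simp
qed

lemma set_integrable_lebesgue_iff_lborel:
  fixes h :: "'e::euclidean_space \<Rightarrow> real"
  assumes [measurable]: "S \<in> sets borel" "h \<in> borel_measurable borel"
  shows "h absolutely_integrable_on S \<longleftrightarrow> set_integrable lborel S h"
    and "set_integrable lborel S h \<Longrightarrow> integral S h = (LINT x:S|lborel. h x)"
proof -
  show *: "h absolutely_integrable_on S \<longleftrightarrow> set_integrable lborel S h"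
    unfolding set_integrable_def by (rule integrable_completion) simp
  assume "set_integrable lborel S h"
  then have "integral S h = (LINT x:S|lebesgue. h x)"
    using * set_lebesgue_integral_eq_integral(2) [of S h] by simp
  also have "\<dots> = (LINT x:S|lborel. h x)"
    unfolding set_lebesgue_integral_def by (rule integral_completion) simp
  finally show "integral S h = (LINT x:S|lborel. h x)" .
qed

text \<open>
  The integrand on \<open>S\<close> is a Borel function \<open>G\<close> of its own that agrees with
  \<open>\<bar>det\<bar> * (F \<circ> g)\<close> on \<open>S\<close>, so that the measurability of the derivative does not enter.
\<close>

lemma lborel_change_of_variables:
  fixes g :: "real ^ 'n::finite \<Rightarrow> real ^ 'n" and F G :: "real ^ 'n \<Rightarrow> real"
  assumes S [measurable]: "S \<in> sets borel" and gS [measurable]: "g ` S \<in> sets borel"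
    and der: "\<And>x. x \<in> S \<Longrightarrow> (g has_derivative g' x) (at x)" and inj: "inj_on g S"
    and F [measurable]: "F \<in> borel_measurable borel" and G [measurable]: "G \<in> borel_measurable borel"
    and FG: "\<And>x. x \<in> S \<Longrightarrow> \<bar>det (matrix (g' x))\<bar> * F (g x) = G x"
    and int: "set_integrable lborel (g ` S) F"
  shows "(LINT x:g ` S|lborel. F x) = (LINT x:S|lborel. G x)"
proof -
  let ?S = "to_wo ` S" and ?g = "to_wo \<circ> g \<circ> of_wo" and ?g' = "\<lambda>w. to_wo \<circ> g' (of_wo w) \<circ> of_wo"
  have img: "to_wo ` X = of_wo -` X" for X :: "(real ^ 'n) set"
    by (auto simp: image_iff) (metis to_of_wo)
  have gimg: "?g ` ?S = to_wo ` (g ` S)" by (auto simp: image_iff)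
  have ind: "indicator (to_wo ` X) w = (indicator X (of_wo w) :: real)" for X :: "(real ^ 'n) set" and w
    unfolding img by (simp add: indicator_def)
  have [measurable]: "to_wo ` X \<in> sets borel" if [measurable]: "X \<in> sets borel" for X :: "(real ^ 'n) set"
    unfolding img using measurable_sets [OF borel_measurable_of_wo that] by simp
  have gS' [measurable]: "?g ` ?S \<in> sets borel" unfolding gimg by measurable
  have transfer: "set_integrable lborel (to_wo ` X) (\<lambda>w. h (of_wo w)) \<longleftrightarrow> set_integrable lborel X h"
    "(LINT w:to_wo ` X|lborel. h (of_wo w)) = (LINT x:X|lborel. h x)"
    if [measurable]: "X \<in> sets borel" "h \<in> borel_measurable borel" for X and h :: "real ^ 'n \<Rightarrow> real"
    using lborel_integral_of_wo [of "\<lambda>x. indicator X x *\<^sub>R h x"]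
    by (simp_all add: set_integrable_def set_lebesgue_integral_def ind)
  have der': "(?g has_derivative ?g' w) (at w within ?S)" if "w \<in> ?S" for w
  proof -
    have "of_wo w \<in> S" using that by auto
    have of: "(of_wo has_derivative of_wo) (at w)"
      by (rule bounded_linear_imp_has_derivative) (simp add: linear_of_wo flip: linear_conv_bounded_linear)
    have to: "(to_wo has_derivative to_wo) (at x)" for x :: "real ^ 'n"
      by (rule bounded_linear_imp_has_derivative) (simp add: linear_to_wo flip: linear_conv_bounded_linear)
    have "(?g has_derivative ?g' w) (at w)"
      by (intro diff_chain_at of to der [OF \<open>of_wo w \<in> S\<close>])
    then show ?thesis by (rule has_derivative_at_withinI)
  qed
  have inj': "inj_on ?g ?S"
    using inj by (auto simp: inj_on_def) (metis of_to_wo)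
  let ?F = "\<lambda>w. vec (F (of_wo w)) :: real ^ 1"
  have "?S \<in> sets lebesgue" by simp
  note cov = has_absolute_integral_change_of_variables [OF this der' inj', of ?F "vec (integral (?g ` ?S) (\<lambda>w. F (of_wo w)))"]
  have F_int: "set_integrable lborel (?g ` ?S) (\<lambda>w. F (of_wo w))"
    unfolding gimg using transfer(1) [OF gS F] int by simp
  then have "(\<lambda>w. F (of_wo w)) absolutely_integrable_on ?g ` ?S"
    by (subst set_integrable_lebesgue_iff_lborel [OF gS']) measurable
  then have "?F absolutely_integrable_on ?g ` ?S \<and>
      integral (?g ` ?S) ?F = vec (integral (?g ` ?S) (\<lambda>w. F (of_wo w)))"
    by (simp add: absolutely_integrable_on_1_iff integral_on_1_eq)
  with cov have "(\<lambda>w. \<bar>det (matrix (?g' w))\<bar> *\<^sub>R ?F (?g w)) absolutely_integrable_on ?S"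
    and eq: "integral ?S (\<lambda>w. \<bar>det (matrix (?g' w))\<bar> *\<^sub>R ?F (?g w)) = vec (integral (?g ` ?S) (\<lambda>w. F (of_wo w)))"
    by auto
  then have abs: "(\<lambda>w. \<bar>det (matrix (?g' w))\<bar> * F (of_wo (?g w))) absolutely_integrable_on ?S"
    and eq': "integral ?S (\<lambda>w. \<bar>det (matrix (?g' w))\<bar> * F (of_wo (?g w))) = integral (?g ` ?S) (\<lambda>w. F (of_wo w))"
    by (simp_all add: absolutely_integrable_on_1_iff integral_on_1_eq vec_eq_iff)
  have G: "\<bar>det (matrix (?g' w))\<bar> * F (of_wo (?g w)) = G (of_wo w)" if "w \<in> ?S" for w
    using that FG by (auto simp: det_to_wo)
  have "(\<lambda>w. G (of_wo w)) absolutely_integrable_on ?S"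
    using iffD1 [OF set_integrable_cong [OF refl refl G] abs] .
  then have G_int: "set_integrable lborel ?S (\<lambda>w. G (of_wo w))"
    by (subst (asm) set_integrable_lebesgue_iff_lborel) simp_all
  have "(LINT x:g ` S|lborel. F x) = (LINT w:?g ` ?S|lborel. F (of_wo w))"
    unfolding gimg by (rule transfer(2) [symmetric]) simp_all
  also have "\<dots> = integral (?g ` ?S) (\<lambda>w. F (of_wo w))"
    by (rule set_integrable_lebesgue_iff_lborel(2) [OF gS' _ F_int, symmetric]) measurable
  also have "\<dots> = integral ?S (\<lambda>w. G (of_wo w))"
    unfolding eq' [symmetric] by (rule integral_cong) (rule G)
  also have "\<dots> = (LINT w:?S|lborel. G (of_wo w))"
    using G_int by (intro set_integrable_lebesgue_iff_lborel(2)) simp_all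
  also have "\<dots> = (LINT x:S|lborel. G x)"
    by (rule transfer(2)) simp_all
  finally show ?thesis .
qed

section \<open>The volume of a volume form\<close>

lemma image_chart_eq_vimage:
  assumes c: "is_chart c" and E: "E \<subseteq> fst c"
  shows "snd c ` E = (snd c ` fst c) \<inter> chart_inv c -` E"
proof (intro equalityI subsetI)
  fix y assume "y \<in> snd c ` E"
  then obtain x where "x \<in> E" "y = snd c x" by blast
  with E show "y \<in> (snd c ` fst c) \<inter> chart_inv c -` E"
    using is_chart_facts(5) [OF c, of x] by auto
next
  fix y assume "y \<in> (snd c ` fst c) \<inter> chart_inv c -` E"
  then show "y \<in> snd c ` E"
    using is_chart_facts(7) [OF c, of y] by (intro image_eqI [of _ _ "chart_inv c y"]) auto
qed

lemma image_chart_borel: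
  assumes c: "is_chart c" and E: "E \<in> sets borel" "E \<subseteq> fst c"
  shows "snd c ` E \<in> sets borel"
proof -
  have "chart_inv c \<in> borel_measurable (restrict_space borel (snd c ` fst c))"
    by (intro borel_measurable_continuous_on_restrict is_chart_facts(4) [OF c])
  from measurable_sets [OF this E(1)]
  have "(snd c ` fst c) \<inter> chart_inv c -` E \<in> sets (restrict_space borel (snd c ` fst c))"
    by (simp add: space_restrict_space Int_commute)
  then show ?thesis
    using is_chart_facts(2) [OF c]
    by (simp add: sets_restrict_space_iff image_chart_eq_vimage [OF c E(2)])
qed

text \<open>
  The absolute value of the coefficient of the volume form in a chart, extended by 0 to the whole
  Euclidean space.
\<close>

definition chart_density ::
  "('a::metric_space, 'n::finite) chart set \<Rightarrow> ('a, 'n) top_form \<Rightarrow> ('a, 'n) chart \<Rightarrow> real ^ 'n \<Rightarrow> real" where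
  "chart_density A \<omega> c y = (if y \<in> snd c ` fst c
     then \<bar>\<omega> (chart_inv c y) (\<lambda>i. tvec_of A c (chart_inv c y) (axis i 1))\<bar> else 0)"

locale volume_manifold =
  fixes A :: "('a::metric_space, 'n::finite) chart set" and r :: enat and \<omega> :: "('a, 'n) top_form"
  assumes atlas: "manifold_atlas r A" and volume: "volume_form r A \<omega>"
begin

lemma atlas_is_chart: "c \<in> A \<Longrightarrow> is_chart c"
  using atlas unfolding manifold_atlas_def by blast

lemma chart_density_continuous:
  assumes "c \<in> A"
  shows "continuous_on (snd c ` fst c) (chart_density A \<omega> c)"
proof -
  have "enat (Suc 0) \<le> r" using atlas unfolding manifold_atlas_def by (simp add: one_enat_def)
  moreover have "\<forall>c\<in>A. \<forall>e. \<forall>k. enat (Suc k) \<le> r \<longrightarrow>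
      Ck_on k (\<lambda>y. \<omega> (chart_inv c y) (\<lambda>i. tvec_of A c (chart_inv c y) (e i))) (snd c ` fst c)"
    using volume unfolding volume_form_def by (elim conjE)
  ultimately have "Ck_on 0 (\<lambda>y. \<omega> (chart_inv c y) (\<lambda>i. tvec_of A c (chart_inv c y) (axis i 1))) (snd c ` fst c)"
    using assms by (elim ballE [of _ _ c] allE [of _ "\<lambda>i. axis i 1"] allE [of _ "0::nat"]) auto
  then have "continuous_on (snd c ` fst c) (\<lambda>y. \<bar>\<omega> (chart_inv c y) (\<lambda>i. tvec_of A c (chart_inv c y) (axis i 1))\<bar>)"
    unfolding Ck_on.simps by (rule continuous_on_rabs)
  then show ?thesis by (rule continuous_on_eq) (simp add: chart_density_def)
qed

lemma chart_density_borel [measurable]: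
  assumes "c \<in> A"
  shows "chart_density A \<omega> c \<in> borel_measurable borel"
proof -
  have "snd c ` fst c \<in> sets borel" using is_chart_facts(2) [OF atlas_is_chart [OF assms]] by (rule borel_open)
  then have "(\<lambda>y. indicator (snd c ` fst c) y *\<^sub>R chart_density A \<omega> c y) \<in> borel_measurable borel"
    by (rule borel_measurable_continuous_on_indicator [OF _ chart_density_continuous [OF assms]])
  also have "(\<lambda>y. indicator (snd c ` fst c) y *\<^sub>R chart_density A \<omega> c y) = chart_density A \<omega> c"
    by (auto simp: chart_density_def indicator_def)
  finally show ?thesis .
qed

lemma chart_density_nonneg: "0 \<le> chart_density A \<omega> c y"
  by (simp add: chart_density_def)

lemma form_of_combinations:
  assumes d: "d \<in> charts_at A x"
  shows "\<omega> x (\<lambda>i. tvec_of A d x (\<Sum>j\<in>UNIV. M $ i $ j *\<^sub>R axis j 1)) = det M * \<omega> x (\<lambda>i. tvec_of A d x (axis i 1))"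
proof (rule alternating_multilinear_det [where \<phi> = "\<lambda>v. \<omega> x (\<lambda>i. tvec_of A d x (v i))"])
  have alt: "alternating_multilinear (tangent_space A x) (\<omega> x)"
    using volume unfolding volume_form_def by blast
  fix v :: "'n \<Rightarrow> real ^ 'n" and i j :: 'n and a b and y z :: "real ^ 'n"
  note tan = tvec_of_in_tangent_space [OF atlas d]
  have upd: "(\<lambda>l. tvec_of A d x ((v(i := w)) l)) = (\<lambda>l. tvec_of A d x (v l))(i := tvec_of A d x w)" for w
    by auto
  show "\<omega> x (\<lambda>l. tvec_of A d x ((v(i := a *\<^sub>R y + b *\<^sub>R z)) l)) =
      a * \<omega> x (\<lambda>l. tvec_of A d x ((v(i := y)) l)) + b * \<omega> x (\<lambda>l. tvec_of A d x ((v(i := z)) l))"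
  proof -
    have "\<forall>v i x' y a b. (\<forall>j. v j \<in> tangent_space A x) \<and> x' \<in> tangent_space A x \<and> y \<in> tangent_space A x \<longrightarrow>
        \<omega> x (v(i := tlin a x' b y)) = a * \<omega> x (v(i := x')) + b * \<omega> x (v(i := y))"
      using alt unfolding alternating_multilinear_def by (elim conjE)
    from this [rule_format, of "\<lambda>l. tvec_of A d x (v l)" "tvec_of A d x y" "tvec_of A d x z" i a b]
    show ?thesis unfolding upd tvec_of_linear_combination [OF atlas d] using tan by blast
  qed
  show "\<omega> x (\<lambda>l. tvec_of A d x (v l)) = 0" if "i \<noteq> j" "v i = v j"
  proof -
    have "\<forall>v i j. (\<forall>l. v l \<in> tangent_space A x) \<and> i \<noteq> j \<and> v i = v j \<longrightarrow> \<omega> x v = 0"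
      using alt unfolding alternating_multilinear_def by (elim conjE)
    from this [rule_format, of "\<lambda>l. tvec_of A d x (v l)" i j] show ?thesis using that tan by simp
  qed
qed

lemma chart_density_pos:
  assumes "c \<in> A" "y \<in> snd c ` fst c"
  shows "chart_density A \<omega> c y > 0"
proof -
  define x where "x = chart_inv c y"
  have c: "c \<in> charts_at A x"
    using assms is_chart_facts(6) [OF atlas_is_chart [OF assms(1)] assms(2)] by (simp add: charts_at_def x_def)
  obtain v where v: "\<And>i. v i \<in> tangent_space A x" "\<omega> x v \<noteq> 0"
    using volume unfolding volume_form_def by blast
  have "v = (\<lambda>i. tvec_of A c x (\<Sum>j\<in>UNIV. (\<chi> i. v i c) $ i $ j *\<^sub>R axis j 1))"
  proof
    fix i
    have "(\<Sum>j\<in>UNIV. (\<chi> i. v i c) $ i $ j *\<^sub>R axis j 1) = v i c"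
      using basis_expansion [of "v i c"] by (simp add: scalar_mult_eq_scaleR)
    then show "v i = tvec_of A c x (\<Sum>j\<in>UNIV. (\<chi> i. v i c) $ i $ j *\<^sub>R axis j 1)"
      using tvec_of_component [OF atlas v(1) c] by simp
  qed
  then have "det (\<chi> i. v i c) * \<omega> x (\<lambda>i. tvec_of A c x (axis i 1)) \<noteq> 0"
    using form_of_combinations [OF c, of "\<chi> i. v i c"] v(2) by metis
  then show ?thesis using assms(2) by (simp add: chart_density_def x_def)
qed

text \<open>
  The Jacobian identity: pulling back by \<open>f\<close> multiplies the coefficient of a top-degree form by the
  determinant of the derivative, and the form is preserved.
\<close>

lemma chart_density_transform:
  assumes f: "chart_differentiable A f x" and pres: "preserves_form A f \<omega>"
    and c: "c \<in> charts_at A x" and d: "d \<in> charts_at A (f x)"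
  shows "\<bar>det (matrix (chart_deriv c d f x))\<bar> * chart_density A \<omega> d (snd d (f x)) = chart_density A \<omega> c (snd c x)"
proof -
  let ?D = "chart_deriv c d f x"
  have chart: "is_chart c" "x \<in> fst c" "is_chart d" "f x \<in> fst d"
    using atlas_charts [OF atlas] c d by blast+
  have lin: "linear ?D" using chart_derivD [OF f c d] by (rule has_derivative_linear)
  have D: "?D (axis i 1) = (\<Sum>j\<in>UNIV. transpose (matrix ?D) $ i $ j *\<^sub>R axis j 1)" for i
    using basis_expansion [of "?D (axis i 1)"] by (simp add: transpose_def matrix_def scalar_mult_eq_scaleR)
  have "\<omega> x (\<lambda>i. tvec_of A c x (axis i 1)) = pullback A f \<omega> x (\<lambda>i. tvec_of A c x (axis i 1))"
    using pres tvec_of_in_tangent_space [OF atlas c] unfolding preserves_form_def by simp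
  also have "\<dots> = \<omega> (f x) (\<lambda>i. tvec_of A d (f x) (?D (axis i 1)))"
    unfolding pullback_def tangent_map_tvec_of [OF atlas f c d] ..
  also have "\<dots> = det (matrix ?D) * \<omega> (f x) (\<lambda>i. tvec_of A d (f x) (axis i 1))"
    unfolding D form_of_combinations [OF d] det_transpose ..
  finally show ?thesis
    using chart by (simp add: chart_density_def is_chart_facts(5) abs_mult)
qed

definition chart_volume :: "('a, 'n) chart \<Rightarrow> 'a set \<Rightarrow> real" where
  "chart_volume c E = (LINT y:snd c ` E|lborel. chart_density A \<omega> c y)"

text \<open>
  The Borel sets in the domain of a chart on which the chart computes a finite volume.
\<close>

definition finite_chart_volume :: "('a, 'n) chart \<Rightarrow> 'a set \<Rightarrow> bool" where
  "finite_chart_volume c E \<longleftrightarrow> c \<in> A \<and> E \<in> sets borel \<and> E \<subseteq> fst c \<and>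
     set_integrable lborel (snd c ` E) (chart_density A \<omega> c)"

lemma finite_chart_volume_subset:
  assumes "finite_chart_volume c V" "E \<in> sets borel" "E \<subseteq> V"
  shows "finite_chart_volume c E"
  using assms set_integrable_subset [of lborel "snd c ` V" "chart_density A \<omega> c" "snd c ` E"]
    image_chart_borel [OF atlas_is_chart, of c E]
  unfolding finite_chart_volume_def by auto

lemma chart_volume_nonneg: "0 \<le> chart_volume c E"
  unfolding chart_volume_def set_lebesgue_integral_def
  by (rule Bochner_Integration.integral_nonneg) (simp add: chart_density_nonneg)

lemma chart_volume_UN:
  assumes V: "finite_chart_volume c V" and "finite I" and disj: "disjoint_family_on E I"
    and E: "\<And>i. i \<in> I \<Longrightarrow> E i \<in> sets borel" "\<And>i. i \<in> I \<Longrightarrow> E i \<subseteq> V"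
  shows "chart_volume c (\<Union>i\<in>I. E i) = (\<Sum>i\<in>I. chart_volume c (E i))"
proof -
  have fin: "finite_chart_volume c (E i)" if "i \<in> I" for i
    using E that by (intro finite_chart_volume_subset [OF V])
  have c: "is_chart c" using V atlas_is_chart unfolding finite_chart_volume_def by blast
  have chart_inv_image: "chart_inv c y \<in> E i" if "i \<in> I" "y \<in> snd c ` E i" for i y
    using that fin [of i] image_chart_eq_vimage [OF c, of "E i"] unfolding finite_chart_volume_def by blast
  have disj': "disjoint_family_on (\<lambda>i. snd c ` E i) I"
    unfolding disjoint_family_on_def
  proof (intro ballI impI equals0I)
    fix i j y assume ij: "i \<in> I" "j \<in> I" "i \<noteq> j" and "y \<in> snd c ` E i \<inter> snd c ` E j"
    then have "chart_inv c y \<in> E i \<inter> E j" using chart_inv_image by blast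
    then show False using ij disj unfolding disjoint_family_on_def by blast
  qed
  have "snd c ` (\<Union>i\<in>I. E i) = (\<Union>i\<in>I. snd c ` E i)" by (rule image_UN)
  then show ?thesis
    using set_integral_finite_Union [OF \<open>finite I\<close> disj', of lborel "chart_density A \<omega> c"] fin c
    unfolding chart_volume_def finite_chart_volume_def by (simp add: image_chart_borel)
qed

lemma chart_volume_Un:
  assumes V: "finite_chart_volume c V" and E: "E \<in> sets borel" "E \<subseteq> V" and F: "F \<in> sets borel" "F \<subseteq> V"
    and disj: "E \<inter> F = {}"
  shows "chart_volume c (E \<union> F) = chart_volume c E + chart_volume c F"
proof -
  let ?D = "\<lambda>b. if b then E else F"
  have "disjoint_family_on ?D UNIV" using disj by (auto simp: disjoint_family_on_def)
  then have "chart_volume c (\<Union>b\<in>UNIV. ?D b) = (\<Sum>b\<in>UNIV. chart_volume c (?D b))"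
    using E F by (intro chart_volume_UN [OF V]) auto
  then show ?thesis by (simp add: UNIV_bool Un_commute)
qed

lemma chart_volume_open_pos:
  assumes V: "finite_chart_volume c V" and "open V" "V \<noteq> {}"
  shows "chart_volume c V > 0"
proof -
  have c: "c \<in> A" and sub: "V \<subseteq> fst c" and borel: "V \<in> sets borel"
    and int: "set_integrable lborel (snd c ` V) (chart_density A \<omega> c)"
    using V by (auto simp: finite_chart_volume_def)
  let ?S = "snd c ` V"
  let ?h = "\<lambda>y. indicator ?S y *\<^sub>R chart_density A \<omega> c y"
  have [measurable]: "?S \<in> sets borel" by (rule image_chart_borel [OF atlas_is_chart [OF c] borel sub])
  have "open ?S"
    unfolding image_chart_eq_vimage [OF atlas_is_chart [OF c] sub]
    by (rule continuous_open_preimage [OF is_chart_facts(4,2) [OF atlas_is_chart [OF c]] \<open>open V\<close>])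
  have "chart_volume c V \<noteq> 0"
  proof
    assume "chart_volume c V = 0"
    then have "AE y in lborel. ?h y = 0"
      using int integral_nonneg_eq_0_iff_AE [of lborel ?h] chart_density_nonneg
      by (simp add: chart_volume_def set_lebesgue_integral_def set_integrable_def)
    moreover have "?h y \<noteq> 0" if "y \<in> ?S" for y
      using that chart_density_pos [OF c, of y] sub by auto
    ultimately have "AE y in lborel. y \<notin> ?S" by (auto elim!: eventually_mono)
    then have "emeasure lborel ?S = 0"
      by (subst (asm) AE_iff_measurable [of ?S]) auto
    then have "negligible ?S" by (simp add: negligible_iff_emeasure0)
    then show False using open_not_negligible [OF \<open>open ?S\<close>] \<open>V \<noteq> {}\<close> by simp
  qed
  then show ?thesis using chart_volume_nonneg [of c V] by simp
qed

text \<open>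
  The change of variables for the coordinate expression of \<open>f\<close>, whose Jacobian is exactly the
  quotient of the two densities.
\<close>

lemma chart_volume_invariant:
  assumes f: "C1_diffeo A f" and pres: "preserves_form A f \<omega>"
    and E: "finite_chart_volume c E" and fE: "finite_chart_volume d (f ` E)"
  shows "chart_volume d (f ` E) = chart_volume c E"
proof -
  have cA: "c \<in> A" and dA: "d \<in> A" and Eb: "E \<in> sets borel" and sub: "E \<subseteq> fst c" "f ` E \<subseteq> fst d"
    using E fE by (auto simp: finite_chart_volume_def)
  note c = atlas_is_chart [OF cA] and d = atlas_is_chart [OF dA]
  let ?g = "local_rep c d f"
  have im: "snd d ` f ` E = ?g ` snd c ` E"
    using sub(1) is_chart_facts(5) [OF c] by (force simp: local_rep_def image_iff)
  have cd: "chart_differentiable A f x" for x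
    using f chart_differentiable_C1 [OF atlas] by (simp add: C1_diffeo_def)
  have ch: "c \<in> charts_at A x" "d \<in> charts_at A (f x)" if "x \<in> E" for x
    using that sub cA dA by (auto simp: charts_at_def)
  have gx: "?g (snd c x) = snd d (f x)" "chart_inv c (snd c x) = x" if "x \<in> E" for x
    using that sub by (auto simp: local_rep_def is_chart_facts(5) [OF c])
  have "(LINT y:?g ` snd c ` E|lborel. chart_density A \<omega> d y) = (LINT y:snd c ` E|lborel. chart_density A \<omega> c y)"
  proof (rule lborel_change_of_variables [where g' = "\<lambda>y. chart_deriv c d f (chart_inv c y)"])
    show "snd c ` E \<in> sets borel" by (rule image_chart_borel [OF c Eb sub(1)])
    show "?g ` snd c ` E \<in> sets borel"
      using fE image_chart_borel [OF d] unfolding im [symmetric] finite_chart_volume_def by blast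
    show "(?g has_derivative chart_deriv c d f (chart_inv c y)) (at y)" if "y \<in> snd c ` E" for y
      using that gx(2) chart_derivD [OF cd ch] by auto
    show "inj_on ?g (snd c ` E)"
    proof (rule inj_onI)
      fix y z assume "y \<in> snd c ` E" "z \<in> snd c ` E" "?g y = ?g z"
      then obtain u v where uv: "u \<in> E" "v \<in> E" "y = snd c u" "z = snd c v" "snd d (f u) = snd d (f v)"
        using gx(1) by auto
      then have "f u = f v" using sub(2) is_chart_facts(5) [OF d] by (metis image_subset_iff)
      then show "y = z" using f uv(3,4) by (simp add: C1_diffeo_def bij_is_inj inj_eq)
    qed
    show "chart_density A \<omega> d \<in> borel_measurable borel" "chart_density A \<omega> c \<in> borel_measurable borel"
      using cA dA by (auto intro: chart_density_borel)
    show "\<bar>det (matrix (chart_deriv c d f (chart_inv c y)))\<bar> * chart_density A \<omega> d (?g y) = chart_density A \<omega> c y"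
      if "y \<in> snd c ` E" for y
      using that gx chart_density_transform [OF cd pres ch] by auto
    show "set_integrable lborel (?g ` snd c ` E) (chart_density A \<omega> d)"
      using fE unfolding im [symmetric] finite_chart_volume_def by blast
  qed
  then show ?thesis by (simp add: chart_volume_def im)
qed

text \<open>
  Small chart balls have finite volume because the density is continuous on a compact ball around
  them.
\<close>

lemma finite_cover_by_chart_domains:
  assumes "compact (UNIV :: 'a set)"
  shows "\<exists>(m::nat) c V. (\<forall>i<m. finite_chart_volume (c i) (V i) \<and> open (V i)) \<and> (\<Union>i<m. V i) = UNIV"
proof -
  have "\<forall>x. \<exists>p. x \<in> snd p \<and> open (snd p) \<and> finite_chart_volume (fst p) (snd p)"
  proof
    fix x
    show "\<exists>p. x \<in> snd p \<and> open (snd p) \<and> finite_chart_volume (fst p) (snd p)"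
  proof -
    obtain c where "c \<in> charts_at A x" using charts_at_nonempty [OF atlas] by blast
    then have cA: "c \<in> A" and xc: "x \<in> fst c" by (auto simp: charts_at_def)
    note c = atlas_is_chart [OF cA]
    obtain \<rho> where \<rho>: "\<rho> > 0" "cball (snd c x) \<rho> \<subseteq> snd c ` fst c"
      using is_chart_facts(2) [OF c] xc open_contains_cball by blast
    let ?V = "fst c \<inter> snd c -` ball (snd c x) \<rho>"
    have "open ?V"
      by (rule continuous_open_preimage [OF is_chart_facts(3,1) [OF c]]) simp
    moreover have "x \<in> ?V" using xc \<rho>(1) by simp
    moreover have "finite_chart_volume c ?V"
      unfolding finite_chart_volume_def
    proof (intro conjI)
      have "set_integrable lborel (cball (snd c x) \<rho>) (chart_density A \<omega> c)"
        unfolding set_integrable_def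
        by (rule borel_integrable_compact)
          (auto intro: continuous_on_subset [OF chart_density_continuous [OF cA] \<rho>(2)])
      then show "set_integrable lborel (snd c ` ?V) (chart_density A \<omega> c)"
        by (rule set_integrable_subset)
          (use image_chart_borel [OF c, of ?V] \<open>open ?V\<close> in auto)
    qed (use cA \<open>open ?V\<close> in auto)
    ultimately show ?thesis by (intro exI [of _ "(c, ?V)"]) simp
    qed
  qed
  then obtain W where W: "\<forall>x. x \<in> snd (W x) \<and> open (snd (W x)) \<and> finite_chart_volume (fst (W x)) (snd (W x))"
    by (rule exE [OF choice])
  define c where "c x = fst (W x)" for x
  define V where "V x = snd (W x)" for x
  have cV: "x \<in> V x" "open (V x)" "finite_chart_volume (c x) (V x)" for x
    using W by (simp_all add: c_def V_def)
  have cover: "UNIV \<subseteq> (\<Union>x\<in>UNIV. V x)" using cV(1) by blast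
  obtain X where X: "finite X" "UNIV \<subseteq> (\<Union>x\<in>X. V x)"
    by (rule compactE_image [OF assms _ cover]) (auto simp: cV(2))
  obtain xs where xs: "set xs = X" using finite_list [OF X(1)] by blast
  show ?thesis
  proof (intro exI [of _ "length xs"] exI [of _ "\<lambda>i. c (xs ! i)"] exI [of _ "\<lambda>i. V (xs ! i)"] conjI)
    show "(\<Union>i<length xs. V (xs ! i)) = UNIV"
      using X(2) unfolding xs [symmetric] by (fastforce simp: in_set_conv_nth)
  qed (use cV in auto)
qed

text \<open>
  A finite cover by chart balls \<open>V i\<close> is made disjoint, \<open>B i = V i - (\<Union>j<i. V j)\<close>, and \<open>\<mu>\<close>
  adds the chart volumes of the pieces.  To compare \<open>f ` E\<close> with \<open>E\<close>, cut \<open>E\<close> into the pieces that lie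
  in \<open>B i\<close> and are mapped into \<open>B j\<close>; \<open>f\<close> preserves the volume of each of them, and the two sums
  differ only in the order of summation.
\<close>

lemma invariant_volume_exists:
  assumes compact: "compact (UNIV :: 'a set)" and f: "C1_diffeo A f" and pres: "preserves_form A f \<omega>"
  shows "\<exists>\<mu>. invariant_volume f \<mu>"
proof -
  obtain m :: nat and c V where V_all: "\<forall>i<m. finite_chart_volume (c i) (V i) \<and> open (V i)"
    and cover: "(\<Union>i<m. V i) = UNIV"
    using finite_cover_by_chart_domains [OF compact] by (elim exE conjE)
  have V: "finite_chart_volume (c i) (V i)" and open_V: "open (V i)" if "i < m" for i
    using V_all that by simp_all
  define B where "B i = V i - (\<Union>j<i. V j)" for i
  have B_sub: "B i \<subseteq> V i" for i by (auto simp: B_def)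
  have B_borel [measurable]: "B i \<in> sets borel" if "i < m" for i
    using that open_V unfolding B_def by (intro sets.Diff borel_open) auto
  have B_disj: "B i \<inter> B j = {}" if "i \<noteq> j" for i j
    using that unfolding B_def by (cases i j rule: linorder_cases) auto
  have B_cover: "\<exists>i<m. x \<in> B i" for x
  proof -
    have ex: "\<exists>i. i < m \<and> x \<in> V i" using cover by blast
    define i where "i = (LEAST i. i < m \<and> x \<in> V i)"
    have i: "i < m \<and> x \<in> V i" unfolding i_def by (rule LeastI_ex [OF ex])
    have "x \<notin> V j" if "j < i" for j
      using not_less_Least [of j "\<lambda>i. i < m \<and> x \<in> V i"] that i unfolding i_def by auto
    then show ?thesis using i by (auto simp: B_def)
  qed
  have bij: "bij f" and cont: "continuous_on UNIV f" and cont_inv: "continuous_on UNIV (inv f)"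
    using f by (auto simp: C1_diffeo_def C1_map_def)
  have im_borel: "f ` E \<in> sets borel" if "E \<in> sets borel" for E
  proof -
    have "inv f \<in> borel_measurable borel" using cont_inv by (rule borel_measurable_continuous_onI)
    then have "inv f -` E \<inter> space borel \<in> sets borel" using that by (rule measurable_sets)
    then show ?thesis
      using bij_vimage_eq_inv_image [OF bij_imp_bij_inv [OF bij], of E] by (simp add: inv_inv_eq bij)
  qed
  have pre_borel: "f -` E \<in> sets borel" if "E \<in> sets borel" for E
    using measurable_sets [OF borel_measurable_continuous_onI [OF cont] that] by simp
  define \<mu> where "\<mu> E = (\<Sum>i<m. chart_volume (c i) (E \<inter> B i))" for E
  have "compact_homeomorphism f"
    using compact bij cont cont_inv by (rule compact_homeomorphism.intro)
  then show ?thesis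
  proof (intro exI [of _ \<mu>] invariant_volume.intro invariant_volume_axioms.intro)
    show "0 \<le> \<mu> E" for E unfolding \<mu>_def by (intro sum_nonneg chart_volume_nonneg)
  next
    fix E F :: "'a set" assume EF: "E \<in> sets borel" "F \<in> sets borel" "E \<inter> F = {}"
    have "chart_volume (c i) ((E \<union> F) \<inter> B i) = chart_volume (c i) (E \<inter> B i) + chart_volume (c i) (F \<inter> B i)" if "i < m" for i
      unfolding Int_Un_distrib2
      using that EF B_sub B_borel by (intro chart_volume_Un [OF V]) auto
    then show "\<mu> (E \<union> F) = \<mu> E + \<mu> F" by (simp add: \<mu>_def sum.distrib)
  next
    fix E :: "'a set" assume E: "E \<in> sets borel"
    have j_sum: "chart_volume (c j) (f ` E \<inter> B j) = (\<Sum>i<m. chart_volume (c i) (E \<inter> f -` B j \<inter> B i))"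
      if j: "j < m" for j
    proof -
      have "f ` E \<inter> B j = (\<Union>i<m. f ` (E \<inter> f -` B j \<inter> B i))" using B_cover by blast
      then have "chart_volume (c j) (f ` E \<inter> B j) = (\<Sum>i<m. chart_volume (c j) (f ` (E \<inter> f -` B j \<inter> B i)))"
      proof (simp only:, intro chart_volume_UN [OF V [OF j]])
        show "disjoint_family_on (\<lambda>i. f ` (E \<inter> f -` B j \<inter> B i)) {..<m}"
          using B_disj bij unfolding disjoint_family_on_def
          by (auto simp: bij_is_inj inj_eq) blast
        show "f ` (E \<inter> f -` B j \<inter> B i) \<in> sets borel" if "i \<in> {..<m}" for i
          using that E j B_borel pre_borel by (intro im_borel) auto
      qed (use B_sub in auto)
      also have "\<dots> = (\<Sum>i<m. chart_volume (c i) (E \<inter> f -` B j \<inter> B i))"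
      proof (intro sum.cong refl chart_volume_invariant [OF f pres])
        fix i assume "i \<in> {..<m}"
        then have i: "i < m" by simp
        have b: "E \<inter> f -` B j \<inter> B i \<in> sets borel" using E B_borel pre_borel i j by auto
        then show "finite_chart_volume (c i) (E \<inter> f -` B j \<inter> B i)"
          using B_sub by (intro finite_chart_volume_subset [OF V [OF i]]) auto
        show "finite_chart_volume (c j) (f ` (E \<inter> f -` B j \<inter> B i))"
          using B_sub by (intro finite_chart_volume_subset [OF V [OF j]] im_borel b) auto
      qed
      finally show ?thesis .
    qed
    have i_sum: "chart_volume (c i) (E \<inter> B i) = (\<Sum>j<m. chart_volume (c i) (E \<inter> f -` B j \<inter> B i))"
      if i: "i < m" for i
    proof -
      have "E \<inter> B i = (\<Union>j<m. E \<inter> f -` B j \<inter> B i)" using B_cover by blast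
      then have "chart_volume (c i) (E \<inter> B i) = chart_volume (c i) (\<Union>j<m. E \<inter> f -` B j \<inter> B i)"
        by (rule arg_cong)
      also have "\<dots> = (\<Sum>j<m. chart_volume (c i) (E \<inter> f -` B j \<inter> B i))"
      proof (rule chart_volume_UN [OF V [OF i]])
        show "disjoint_family_on (\<lambda>j. E \<inter> f -` B j \<inter> B i) {..<m}"
          using B_disj unfolding disjoint_family_on_def by blast
        show "E \<inter> f -` B j \<inter> B i \<in> sets borel" if "j \<in> {..<m}" for j
          using that E i B_borel pre_borel by auto
      qed (use B_sub in auto)
      finally show ?thesis .
    qed
    have "\<mu> (f ` E) = (\<Sum>j<m. \<Sum>i<m. chart_volume (c i) (E \<inter> f -` B j \<inter> B i))"
      by (simp add: \<mu>_def j_sum)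
    also have "\<dots> = (\<Sum>i<m. \<Sum>j<m. chart_volume (c i) (E \<inter> f -` B j \<inter> B i))"
      by (rule sum.swap)
    also have "\<dots> = \<mu> E" by (simp add: \<mu>_def i_sum)
    finally show "\<mu> (f ` E) = \<mu> E" .
  next
    fix U :: "'a set" assume U: "open U" "U \<noteq> {}"
    have ex: "\<exists>i. i < m \<and> U \<inter> V i \<noteq> {}" using U(2) cover by blast
    \<comment> \<open>For the first ball that meets \<open>U\<close>, nothing of \<open>U \<inter> V i\<close> is removed in \<open>B i\<close>, so the
      piece is open.\<close>
    define i where "i = (LEAST i. i < m \<and> U \<inter> V i \<noteq> {})"
    have i: "i < m \<and> U \<inter> V i \<noteq> {}" unfolding i_def by (rule LeastI_ex [OF ex])
    have "U \<inter> V j = {}" if "j < i" for j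
      using not_less_Least [of j "\<lambda>i. i < m \<and> U \<inter> V i \<noteq> {}"] that i unfolding i_def by auto
    then have UB: "U \<inter> B i = U \<inter> V i" by (auto simp: B_def)
    have "open (U \<inter> V i)" using U(1) open_V i by auto
    then have "0 < chart_volume (c i) (U \<inter> B i)"
      unfolding UB using i by (intro chart_volume_open_pos finite_chart_volume_subset [OF V]) auto
    also have "\<dots> \<le> \<mu> U"
      unfolding \<mu>_def using i by (intro member_le_sum chart_volume_nonneg) auto
    finally show "0 < \<mu> U" .
  qed
qed

end

section \<open>Limits of homoclinic points\<close>

theorem theorem5p3:
  fixes A :: "('a::metric_space, 'n::finite) chart set"
    and r :: enat
    and \<omega> :: "('a, 'n) top_form"
    and f :: "'a \<Rightarrow> 'a"
    and p q :: 'a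
    and k :: nat
  assumes "manifold_atlas r A"
    and "compact (UNIV :: 'a set)"
    and "volume_form r A \<omega>"
    and "C1_diffeo A f"
    and "preserves_form A f \<omega>"
    and "hyperbolic_periodic_point A f k p"
    and "shadowing_property f"
    and "q \<in> unstable_manifold f p"
    and "recurrent_point f q"
  shows "\<exists>h :: nat \<Rightarrow> 'a. (\<forall>j. h j \<in> homoclinic_points f p) \<and> h \<longlonglongrightarrow> q"
proof -
  interpret volume_manifold A r \<omega>
    using assms(1,3) by unfold_locales
  interpret compact_homeomorphism f
    using assms(2,4) by unfold_locales (auto simp: C1_diffeo_def C1_map_def)
  obtain \<epsilon>0 where \<epsilon>0: "\<epsilon>0 > 0" "isolated_fixed_point (f ^^ k) p \<epsilon>0"
    by (rule hyperbolic_isolated [OF assms(1,4,6)])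
  interpret isolated_periodic_point f p k \<epsilon>0
    using assms(6,7) \<epsilon>0 by unfold_locales (auto simp: hyperbolic_periodic_point_def)
  show ?thesis
  proof (cases "q = p")
    case False
    have "\<forall>j. \<exists>h. h \<in> homoclinic_points f p \<and> dist h q < inverse (real (Suc j))"
    proof
      fix j
      have "0 < inverse (real (Suc j))" by simp
      from homoclinic_near_recurrent_unstable [OF assms(8) False assms(9) this]
      show "\<exists>h. h \<in> homoclinic_points f p \<and> dist h q < inverse (real (Suc j))" by blast
    qed
    then obtain h where h: "\<forall>j. h j \<in> homoclinic_points f p \<and> dist (h j) q < inverse (real (Suc j))"
      by (rule exE [OF choice])
    have "(\<lambda>j. dist (h j) q) \<longlonglongrightarrow> 0"
      by (rule tendsto_sandwich [OF _ _ tendsto_const LIMSEQ_inverse_real_of_nat])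
        (use h in \<open>auto intro!: always_eventually less_imp_le\<close>)
    then have "h \<longlonglongrightarrow> q" by (subst tendsto_dist_iff)
    with h show ?thesis by blast
  next
    case True
    obtain \<mu> where "invariant_volume f \<mu>"
      using invariant_volume_exists [OF assms(2,4,5)] by (elim exE)
    then interpret invariant_volume f \<mu> .
    obtain c where "c \<in> charts_at A p" using charts_at_nonempty [OF assms(1)] by blast
    then have chart: "is_chart c" and pc: "p \<in> fst c" using atlas_charts [OF assms(1)] by blast+
    obtain \<rho> where \<rho>: "\<rho> > 0" "ball (snd c p) \<rho> \<subseteq> snd c ` fst c"
      using is_chart_facts(2) [OF chart] pc by (meson imageI open_contains_ball)
    let ?X = "chart_inv c ` ball (snd c p) \<rho>"
    have "connected ?X"
      by (rule connected_continuous_image [OF continuous_on_subset [OF is_chart_facts(4) [OF chart] \<rho>(2)]]) simp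
    have "p \<in> ?X"
      using \<rho>(1) is_chart_facts(5) [OF chart pc] by (intro image_eqI [of _ _ "snd c p"]) auto
    have "inj_on (chart_inv c) (ball (snd c p) \<rho>)"
      by (rule inj_on_inverseI [of _ "snd c"]) (use \<rho>(2) is_chart_facts(7) [OF chart] in blast)
    then have "infinite ?X"
      using uncountable_ball [OF \<rho>(1)] countable_finite by (metis finite_imageD)
    moreover have "range (\<lambda>j. (f ^^ j) p) \<subseteq> (\<lambda>j. (f ^^ j) p) ` {..<k}"
      using funpow_mod_eq [OF p] k by (metis image_subsetI imageI lessThan_iff mod_less_divisor)
    then have "finite (range (\<lambda>j. (f ^^ j) p))" by (rule finite_subset) simp
    ultimately obtain x0 where x0: "x0 \<in> ?X" "x0 \<notin> range (\<lambda>j. (f ^^ j) p)"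
      by (meson finite_subset subsetI)
    have "\<exists>y. y \<in> homoclinic_points f p"
    proof (rule homoclinic_from_chains [of x0])
      show "(p, x0) \<in> (chain_step f \<delta>)\<^sup>* \<and> (x0, p) \<in> (chain_step f \<delta>)\<^sup>*" if "\<delta> > 0" for \<delta>
        using connected_chain [OF that \<open>connected ?X\<close>] \<open>p \<in> ?X\<close> x0(1) by (auto intro: trancl_into_rtrancl)
      show "x0 \<noteq> (f ^^ j) p" for j using x0(2) by blast
    qed
    then show ?thesis using homoclinic_sequence_to_periodic_point True by blast
  qed
qed

end
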